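(* Let $m,n\ge 2$ be integers and let $p_1,\dots,p_m>0$ with $\sum_{i=1}^m p_i=1$ be the symbol probabilities of a Bernoulli source. Then there exist a constant $c>0$ (depending only on $n$ and $p_1,\dots,p_m$), an infinite set $\mathcal T$ of positive integers, and for each $T\in\mathcal T$ a decipherable word-based code from the source alphabet $\{a_1,\dots,a_m\}$ to the output alphabet $\{b_1,\dots,b_n\}$, with redundancy $R=R_T$, average delay $\bar N=\bar N_T\ge 2$ and maximum delay $N=N_T$, such that $\bar N_T\to\infty$ as $T\to\infty$, $T\in\mathcal T$, and for all $T\in\mathcal T$ $$R\le c\,\bar N^{-5/3},\qquad N\le c\,\bar N\ln\bar N .$$
   Context: A Bernoulli source produces independent symbols from the input alphabet $\{a_1,\dots,a_m\}$ with probabilities $p_1,\dots,p_m$; its entropy is $H=-\sum_{i=1}^m p_i\log_2 p_i$. A message is an infinite sequence of input symbols. For a word $A=a_{i_1}\cdots a_{i_k}$, $|A|=k$ is its length and $p(A)=p_{i_1}\cdots p_{i_k}$. A word-based code consists of a finite set of distinct nonempty words $A_1,A_2,\dots$ over the input alphabet such that every message can be uniquely represented as an infinite concatenation of words $A_j$ (in particular, the set is prefix-free and every message begins with one of its words), together with a map $\phi$ assigning to each $A_j$ a word $\phi(A_j)$ over the output alphabet $\{b_1,\dots,b_n\}$. The code is decipherable if $\phi(A_{i_1})\cdots\phi(A_{i_s})=\phi(A_{j_1})\cdots\phi(A_{j_t})$ always implies $s=t$ and $i_k=j_k$ for $k=1,\dots,s$. Average delay: $\bar N=\sum_j p(A_j)|A_j|$.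 Maximum delay: $N=\max_j|A_j|$. Redundancy: $R=\bar N^{-1}\sum_j p(A_j)|\phi(A_j)|-H/\log_2 n$. *)

theory Defs
  imports Complex_Main "HOL-Library.Stream"
begin

text \<open>
  The source alphabet is \<open>{..<m}\<close> and the output alphabet is \<open>{..<n}\<close>; the symbol \<open>i\<close> has
  probability \<open>p i\<close>. Words are lists and messages are streams over \<open>{..<m}\<close>.
\<close>

definition entropy :: "nat \<Rightarrow> (nat \<Rightarrow> real) \<Rightarrow> real" where
  "entropy m p = - (\<Sum>i<m. p i * log 2 (p i))"

definition word_prob :: "(nat \<Rightarrow> real) \<Rightarrow> nat list \<Rightarrow> real" where
  "word_prob p w = prod_list (map p w)"

text \<open>
  The condition \<open>[] \<notin> W\<close> is also what makes \<^const>\<open>flat\<close> the infinite concatenation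
  of a stream of words. The map \<open>\<phi>\<close> is only relevant on \<open>W\<close>.
\<close>

definition word_based_code ::
    "nat \<Rightarrow> nat \<Rightarrow> nat list set \<Rightarrow> (nat list \<Rightarrow> nat list) \<Rightarrow> bool" where
  "word_based_code m n W \<phi> \<longleftrightarrow>
     finite W \<and> W \<subseteq> lists {..<m} \<and> [] \<notin> W \<and>
     (\<forall>x \<in> streams {..<m}. \<exists>!ws. ws \<in> streams W \<and> flat ws = x) \<and>
     \<phi> ` W \<subseteq> lists {..<n}"

definition decipherable :: "nat list set \<Rightarrow> (nat list \<Rightarrow> nat list) \<Rightarrow> bool" where
  "decipherable W \<phi> \<longleftrightarrow>
     (\<forall>us \<in> lists W. \<forall>vs \<in> lists W. concat (map \<phi> us) = concat (map \<phi> vs) \<longrightarrow> us = vs)"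

definition avg_delay :: "(nat \<Rightarrow> real) \<Rightarrow> nat list set \<Rightarrow> real" where
  "avg_delay p W = (\<Sum>A\<in>W. word_prob p A * real (length A))"

definition max_delay :: "nat list set \<Rightarrow> nat" where
  "max_delay W = Max (length ` W)"

definition redundancy ::
    "nat \<Rightarrow> nat \<Rightarrow> (nat \<Rightarrow> real) \<Rightarrow> nat list set \<Rightarrow> (nat list \<Rightarrow> nat list) \<Rightarrow> real" where
  "redundancy m n p W \<phi> =
     (\<Sum>A\<in>W. word_prob p A * real (length (\<phi> A))) / avg_delay p W
       - entropy m p / log 2 (real n)"

end

theory Submission
  imports Defs "HOL-Library.Sublist" "HOL-Analysis.Weierstrass_Theorems"
    "HOL-Analysis.Kronecker_Approximation_Theorem"
begin

text \<open>
  Give the word \<open>w\<close> the phase \<open>- log n p(w)\<close>. A word whose phase is within \<open>e\<close> of an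
  integer can be coded with that length almost without loss: if such words exhaust a complete prefix
  set and their Kraft sum is \<open>1 - O(e\<^sup>2)\<close>, the expected excess length is \<open>O(e\<^sup>2)\<close>, because
  the first-order rounding errors cancel.

  The phase performs a random walk modulo \<open>1\<close>. If two symbols have costs with irrational
  difference \<open>\<alpha>\<close> and \<open>q\<close> is the denominator of a good rational approximation of \<open>\<alpha>\<close>, then among
  any \<open>q\<close> consecutive multiples of \<open>\<alpha>\<close> one brings the phase within \<open>3 / q\<close> of an integer on a
  prescribed side; after \<open>O(q\<^sup>2)\<close> symbols the binomial distribution gives it probability at
  least \<open>const / q\<close>. If all differences of costs are rational, a bounded number of final symbols
  reduces the walk to a rotation. Hence a stopping rule with \<open>e = 3 / q\<close> has average delay of order
  \<open>q ^ 3\<close>, which makes the redundancy \<open>O(q powr - 2 / q ^ 3)\<close>, and truncating it after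
  order \<open>q ^ 3 * ln q\<close> symbols costs only \<open>O(q powr - 2)\<close>.
\<close>

section \<open>Prefix codes\<close>

text \<open>Codewords are chosen greedily in order of increasing length. A codeword of length
  \<open>l y\<close> rules out \<open>n ^ (l x - l y)\<close> words of length \<open>l x\<close>;
  the Kraft inequality leaves at least one word of that length free.\<close>

lemma kraft_converse:
  fixes l :: "'a \<Rightarrow> nat" and n :: nat
  assumes "finite W" and "n > 0" and "(\<Sum>w\<in>W. 1 / real n ^ l w) \<le> 1"
  shows "\<exists>\<phi>. (\<forall>w\<in>W. \<phi> w \<in> lists {..<n} \<and> length (\<phi> w) = l w) \<and>
             (\<forall>v\<in>W. \<forall>w\<in>W. prefix (\<phi> v) (\<phi> w) \<longrightarrow> v = w)"
  using assms(1,3)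
proof (induction W rule: finite_ranking_induct[where f = l])
  case empty
  then show ?case by simp
next
  case (insert x S)
  show ?case
  proof (cases "x \<in> S")
    case True
    then show ?thesis using insert by (simp add: insert_absorb)
  next
    case False
    have sum_insert: "1 / real n ^ l x + (\<Sum>w\<in>S. 1 / real n ^ l w) \<le> 1"
      using insert.prems insert.hyps(1) False by simp
    have pos: "1 / real n ^ l x > 0" using assms(2) by simp
    then have less: "(\<Sum>w\<in>S. 1 / real n ^ l w) < 1" using sum_insert by linarith
    then obtain \<phi> where \<phi>: "\<forall>w\<in>S. \<phi> w \<in> lists {..<n} \<and> length (\<phi> w) = l w"
      "\<forall>v\<in>S. \<forall>w\<in>S. prefix (\<phi> v) (\<phi> w) \<longrightarrow> v = w"
      using insert.IH by auto
    define words where "words k = {z. set z \<subseteq> {..<n} \<and> length z = k}" for k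
    have fin: "finite (words k)" and card: "card (words k) = n ^ k" for k
      unfolding words_def by (simp_all add: finite_lists_length_eq card_lists_length_eq)
    define Bad where "Bad = (\<Union>y\<in>S. (\<lambda>z. \<phi> y @ z) ` words (l x - l y))"
    have "card Bad \<le> (\<Sum>y\<in>S. card ((\<lambda>z. \<phi> y @ z) ` words (l x - l y)))"
      unfolding Bad_def by (rule card_UN_le[OF insert.hyps(1)])
    also have "\<dots> \<le> (\<Sum>y\<in>S. n ^ (l x - l y))"
      by (intro sum_mono) (metis card card_image_le fin)
    finally have "real (card Bad) \<le> (\<Sum>y\<in>S. real n ^ (l x - l y))"
      by (metis (mono_tags, lifting) of_nat_le_iff of_nat_power of_nat_sum sum.cong)
    also have "\<dots> = (\<Sum>y\<in>S. real n ^ l x * (1 / real n ^ l y))"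
      using insert.hyps(2) assms(2) by (intro sum.cong) (auto simp: power_diff)
    also have "\<dots> = real n ^ l x * (\<Sum>y\<in>S. 1 / real n ^ l y)"
      by (simp add: sum_distrib_left)
    also have "\<dots> < real n ^ l x * 1"
      using less assms(2) by (intro mult_strict_left_mono) auto
    finally have "card Bad < card (words (l x))"
      by (simp add: card flip: of_nat_power)
    moreover have "finite Bad" unfolding Bad_def using fin insert.hyps(1) by auto
    ultimately obtain w where w: "w \<in> words (l x)" "w \<notin> Bad"
      by (metis card_mono leD subsetI)
    have not_prefix: "\<not> prefix (\<phi> y) w" if y: "y \<in> S" for y
    proof
      assume "prefix (\<phi> y) w"
      then obtain z where z: "w = \<phi> y @ z" by (auto simp: prefix_def)
      then have "z \<in> words (l x - l y)" using w(1) \<phi>(1) y by (auto simp: words_def)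
      then show False using w(2) y z by (auto simp: Bad_def)
    qed
    \<comment> \<open>Earlier codewords are no longer than \<open>w\<close>, so this case collapses
      to equality, which \<open>not_prefix\<close> excludes.\<close>
    have not_prefix': "\<not> prefix w (\<phi> y)" if y: "y \<in> S" for y
    proof
      assume pre: "prefix w (\<phi> y)"
      have "length (\<phi> y) \<le> length w" using y \<phi>(1) w(1) insert.hyps(2) by (auto simp: words_def)
      then have "w = \<phi> y" using pre by (auto simp: prefix_def)
      then show False using not_prefix[OF y] by simp
    qed
    show ?thesis
    proof (intro exI[of _ "\<phi>(x := w)"] conjI ballI impI)
      fix v assume "v \<in> insert x S"
      then show "(\<phi>(x := w)) v \<in> lists {..<n}" "length ((\<phi>(x := w)) v) = l v"
        using \<phi>(1) w(1) by (auto simp: words_def lists_eq_set)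
    next
      fix v u assume "v \<in> insert x S" "u \<in> insert x S" 
        "prefix ((\<phi>(x := w)) v) ((\<phi>(x := w)) u)"
      then show "v = u"
        using \<phi>(2) not_prefix not_prefix' by (auto split: if_splits)
    qed
  qed
qed

text \<open>Of the two leading codewords one is a prefix of the other, so they agree and can be
  cancelled. Nonemptiness prevents a nonempty list of words from encoding to the empty word.\<close>

lemma decipherable_if_prefix_free:
  assumes pf: "\<And>v w. v \<in> W \<Longrightarrow> w \<in> W \<Longrightarrow> prefix (\<phi> v) (\<phi> w) \<Longrightarrow> v = w"
    and ne: "\<And>w. w \<in> W \<Longrightarrow> \<phi> w \<noteq> []"
  shows "decipherable W \<phi>"
proof -
  have "us = vs" if "us \<in> lists W" "vs \<in> lists W" "concat (map \<phi> us) = concat (map \<phi> vs)" for us vs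
    using that
  proof (induction us arbitrary: vs)
    case Nil
    then show ?case using ne by (cases vs) auto
  next
    case (Cons a us)
    then obtain b vs' where vs: "vs = b # vs'" using ne by (cases vs) auto
    have eq: "\<phi> a @ concat (map \<phi> us) = \<phi> b @ concat (map \<phi> vs')" using Cons.prems vs by simp
    then have "prefix (\<phi> a) (\<phi> b) \<or> prefix (\<phi> b) (\<phi> a)"
      by (metis prefix_same_cases prefixI)
    moreover have "a \<in> W" "b \<in> W" using Cons.hyps(1) Cons.prems(1) vs by simp_all
    ultimately have ab: "a = b" using pf by metis
    have "concat (map \<phi> us) = concat (map \<phi> vs')" using eq unfolding ab by simp
    then have "us = vs'" using Cons.IH[of vs'] Cons.prems(1) vs by simp
    then show ?case using ab vs by simp
  qed
  then show ?thesis unfolding decipherable_def by blast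
qed

lemma stream_eqI:
  assumes "\<And>i. s !! i = t !! i"
  shows "s = t"
proof -
  have "snth s = snth t" using assms by (rule ext)
  then have "smap (snth s) nats = smap (snth t) nats" by simp
  then show ?thesis by (simp flip: stream_smap_nats)
qed

text \<open>Existence: cut off a word of \<open>W\<close> at the front again and again. Uniqueness:
  the first words of two factorizations are prefixes of the same stream, hence comparable, hence
  equal.\<close>

lemma unique_flat_if_prefix_free:
  fixes W :: "'a list set"
  assumes pf: "\<And>v w. v \<in> W \<Longrightarrow> w \<in> W \<Longrightarrow> prefix v w \<Longrightarrow> v = w"
    and ne: "[] \<notin> W" and x: "x \<in> streams A"
    and complete: "\<And>x. x \<in> streams A \<Longrightarrow> \<exists>k. stake k x \<in> W"
  shows "\<exists>!ws. ws \<in> streams W \<and> flat ws = x"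
proof (rule ex_ex1I)
  define k where "k y = (SOME k. stake k y \<in> W)" for y
  have k: "stake (k y) y \<in> W" if "y \<in> streams A" for y
    unfolding k_def using complete[OF that] by (rule someI_ex)
  define ws where "ws y = smap (\<lambda>x. stake (k x) x) (siterate (\<lambda>x. sdrop (k x) x) y)" for y
  have ws_unfold: "ws y = stake (k y) y ## ws (sdrop (k y) y)" for y
    unfolding ws_def by (subst siterate.code) simp
  have sdrop_in: "sdrop j y \<in> streams A" if "y \<in> streams A" for y j
    using that by (induction j arbitrary: y) (auto intro: streams_stl)
  have ws_in: "ws y !! i \<in> W" if "y \<in> streams A" for y i
    using that
  proof (induction i arbitrary: y)
    case 0
    then show ?case using k by (subst ws_unfold) simp
  next
    case (Suc i)
    then show ?case using sdrop_in[of y] by (subst ws_unfold) simp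
  qed
  \<comment> \<open>Strong induction on the position: every word cut off is nonempty, so the
    position relative to the remaining stream is smaller.\<close>
  have "flat (ws y) !! i = y !! i" if "y \<in> streams A" for y i
    using that
  proof (induction i arbitrary: y rule: less_induct)
    case (less i)
    have nonempty: "stake (k y) y \<noteq> []" using k[OF less.prems] ne by metis
    then have kpos: "k y > 0" by (cases "k y") auto
    have "flat (ws y) !! i = (stake (k y) y @- flat (ws (sdrop (k y) y))) !! i"
      using nonempty by (subst ws_unfold) simp
    also have "\<dots> = y !! i"
    proof (cases "i < k y")
      case True
      then show ?thesis by simp
    next
      case False
      have "sdrop (k y) y \<in> streams A" using less.prems by (rule sdrop_in)
      then show ?thesis using False kpos less.IH[of "i - k y" "sdrop (k y) y"] by (simp add: sdrop_snth)
    qed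
    finally show ?case .
  qed
  then have "flat (ws x) = x" using stream_eqI x by metis
  moreover have "ws x \<in> streams W" using ws_in[OF x] by (simp add: streams_iff_snth)
  ultimately show "\<exists>ws. ws \<in> streams W \<and> flat ws = x" by blast
next
  have pre: "prefix v w" if "v @- s = w @- t" "length v \<le> length w" for v w :: "'a list" and s t
  proof -
    have "v = stake (length v) (w @- t)" by (simp add: stake_shift flip: that(1))
    also have "\<dots> = take (length v) w" using that(2) by (simp add: stake_shift)
    finally show ?thesis by (metis take_is_prefix)
  qed
  have step: "shd vs = shd ws \<and> flat (stl vs) = flat (stl ws)"
    if a: "vs \<in> streams W" "ws \<in> streams W" "flat vs = flat ws" for vs ws
  proof -
    have in_W: "shd vs \<in> W" "shd ws \<in> W" using a by (auto intro: streams_shd)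
    then have nonempty: "shd vs \<noteq> []" "shd ws \<noteq> []" using ne by auto
    have eq: "shd vs @- flat (stl vs) = shd ws @- flat (stl ws)"
      using flat_unfold[OF nonempty(1)] flat_unfold[OF nonempty(2)] a(3) by simp
    have "shd vs = shd ws"
    proof (cases "length (shd vs) \<le> length (shd ws)")
      case True
      then show ?thesis using pre[OF eq] pf in_W by blast
    next
      case False
      then show ?thesis using pre[OF eq[symmetric]] pf in_W by (metis nle_le)
    qed
    then show ?thesis using eq by simp
  qed
  have snth_eq: "vs !! i = ws !! i" if "vs \<in> streams W" "ws \<in> streams W" "flat vs = flat ws" for vs ws i
    using that
  proof (induction i arbitrary: vs ws)
    case 0
    then show ?case using step[OF 0] by simp
  next
    case (Suc i)
    then show ?case using step[OF Suc.prems] Suc.IH[of "stl vs" "stl ws"]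
      by (simp add: streams_stl)
  qed
  fix vs ws assume vs: "vs \<in> streams W \<and> flat vs = x" and ws: "ws \<in> streams W \<and> flat ws = x"
  show "vs = ws"
  proof (rule stream_eqI)
    show "vs !! i = ws !! i" for i
      using vs ws by (intro snth_eq) simp_all
  qed
qed

section \<open>Stopping a Bernoulli source\<close>

locale bernoulli_source =
  fixes m :: nat and p :: "nat \<Rightarrow> real"
  assumes m_ge_2: "m \<ge> 2"
    and p_pos: "\<And>i. i < m \<Longrightarrow> p i > 0"
    and sum_p: "(\<Sum>i<m. p i) = 1"
begin

text \<open>
  \<open>stop_mean S G u T\<close> is the expected value of \<open>G\<close> at the word reached from \<open>u\<close> when reading
  symbols until \<open>S\<close> holds or \<open>T\<close> symbols have been read; for \<open>S = (\<lambda>_. False)\<close>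
  it is the mean of \<open>G\<close> over all extensions of \<open>u\<close> by \<open>T\<close> symbols.
\<close>

fun stop_mean :: "(nat list \<Rightarrow> bool) \<Rightarrow> (nat list \<Rightarrow> real) \<Rightarrow> nat list \<Rightarrow> nat \<Rightarrow> real" where
  "stop_mean S G u 0 = G u"
| "stop_mean S G u (Suc T) = (if S u then G u else \<Sum>i<m. p i * stop_mean S G (u @ [i]) T)"

text \<open>The set holds the continuations read after \<open>u\<close>, not the full words
  \<open>u @ w\<close>; the rule \<open>S\<close>, however, is applied to the full word.\<close>

fun stop_tree :: "(nat list \<Rightarrow> bool) \<Rightarrow> nat list \<Rightarrow> nat \<Rightarrow> nat list set" where
  "stop_tree S u 0 = {[]}"
| "stop_tree S u (Suc T) = (if S u then {[]} else \<Union>i<m. (#) i ` stop_tree S (u @ [i]) T)"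

abbreviation mean :: "(nat list \<Rightarrow> real) \<Rightarrow> nat list \<Rightarrow> nat \<Rightarrow> real" where
  "mean \<equiv> stop_mean (\<lambda>_. False)"

lemma p_nonneg: "i < m \<Longrightarrow> 0 \<le> p i"
  using p_pos by (simp add: less_imp_le)

lemma finite_stop_tree: "finite (stop_tree S u T)"
  by (induction T arbitrary: u) auto

lemma stop_tree_lists: "w \<in> stop_tree S u T \<Longrightarrow> w \<in> lists {..<m}"
proof (induction T arbitrary: u w)
  case (Suc T)
  show ?case
  proof (cases "S u")
    case False
    then obtain i v where "i < m" "w = i # v" "v \<in> stop_tree S (u @ [i]) T" using Suc.prems by auto
    then show ?thesis using Suc.IH by simp
  qed (use Suc.prems in simp)
qed simp

lemma length_stop_tree: "w \<in> stop_tree S u T \<Longrightarrow> length w \<le> T"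
  by (induction T arbitrary: u w) (auto split: if_splits)

lemma length_stop_tree_ge:
  assumes "w \<in> stop_tree S u (t + T)" and "\<And>v. length v < length u + t \<Longrightarrow> \<not> S v"
  shows "length w \<ge> t"
  using assms
proof (induction t arbitrary: u w)
  case (Suc t)
  then have "\<not> S u" by simp
  then obtain i v where "w = i # v" "v \<in> stop_tree S (u @ [i]) (t + T)"
    using Suc.prems(1) by auto
  then show ?case using Suc.IH[of v "u @ [i]"] Suc.prems(2) by simp
qed simp

lemma stop_tree_prefix_free:
  "v \<in> stop_tree S u T \<Longrightarrow> w \<in> stop_tree S u T \<Longrightarrow> prefix v w \<Longrightarrow> v = w"
  by (induction T arbitrary: u v w) (auto split: if_splits)

lemma stop_tree_complete:
  assumes "x \<in> streams {..<m}"
  shows "\<exists>k. stake k x \<in> stop_tree S u T"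
  using assms
proof (induction T arbitrary: u x)
  case 0
  show ?case by (rule exI[of _ 0]) simp
next
  case (Suc T)
  show ?case
  proof (cases "S u")
    case True
    then show ?thesis by (intro exI[of _ 0]) simp
  next
    case False
    obtain k where "stake k (stl x) \<in> stop_tree S (u @ [shd x]) T"
      using Suc streams_stl by blast
    moreover have "shd x < m" using Suc.prems streams_shd by fastforce
    ultimately show ?thesis using False by (intro exI[of _ "Suc k"]) auto
  qed
qed

text \<open>The bridge between the recursive mean and the sums over code words: monotonicity and
  linearity of \<open>stop_mean\<close> are inherited from finite sums, and the sums in
  \<open>avg_delay\<close> and \<open>redundancy\<close> become stopped means.\<close>

lemma sum_stop_tree:
  "(\<Sum>w\<in>stop_tree S u T. word_prob p w * G (u @ w)) = stop_mean S G u T"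
proof (induction T arbitrary: u)
  case 0
  then show ?case by (simp add: word_prob_def)
next
  case (Suc T)
  show ?case
  proof (cases "S u")
    case True
    then show ?thesis by (simp add: word_prob_def)
  next
    case False
    have "(\<Sum>w\<in>stop_tree S u (Suc T). word_prob p w * G (u @ w)) =
      (\<Sum>i<m. \<Sum>w\<in>(#) i ` stop_tree S (u @ [i]) T. word_prob p w * G (u @ w))"
      using False by (simp, subst sum.UNION_disjoint) (auto simp: finite_stop_tree)
    also have "\<dots> = (\<Sum>i<m. \<Sum>w\<in>stop_tree S (u @ [i]) T. p i * (word_prob p w * G ((u @ [i]) @ w)))"
      by (rule sum.cong[OF refl], subst sum.reindex) (auto simp: word_prob_def mult.assoc)
    also have "\<dots> = stop_mean S G u (Suc T)"
      using False by (simp flip: sum_distrib_left Suc)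
    finally show ?thesis .
  qed
qed

lemma word_prob_nonneg: "w \<in> lists {..<m} \<Longrightarrow> 0 \<le> word_prob p w"
  by (induction w) (auto simp: word_prob_def p_nonneg)

section \<open>Monotonicity, linearity, optional stopping and the Markov property of stopped
  means\<close>

lemma stop_mean_mono_tree:
  assumes "\<And>w. w \<in> stop_tree S u T \<Longrightarrow> G (u @ w) \<le> G' (u @ w)"
  shows "stop_mean S G u T \<le> stop_mean S G' u T"
  unfolding sum_stop_tree[symmetric]
  by (intro sum_mono mult_left_mono assms word_prob_nonneg) (auto dest: stop_tree_lists)

lemma stop_mean_mono:
  assumes "\<And>w. w \<in> lists {..<m} \<Longrightarrow> G (u @ w) \<le> G' (u @ w)"
  shows "stop_mean S G u T \<le> stop_mean S G' u T"
  by (rule stop_mean_mono_tree) (blast intro: assms dest: stop_tree_lists)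

lemma stop_mean_cong:
  assumes "\<And>w. w \<in> lists {..<m} \<Longrightarrow> G (u @ w) = G' (u @ w)"
    and "\<And>w. w \<in> lists {..<m} \<Longrightarrow> S (u @ w) = S' (u @ w)"
  shows "stop_mean S G u T = stop_mean S' G' u T"
  using assms
proof (induction T arbitrary: u)
  case 0
  then show ?case by (metis append_Nil2 lists.Nil stop_mean.simps(1))
next
  case (Suc T)
  have "stop_mean S G (u @ [i]) T = stop_mean S' G' (u @ [i]) T" if "i < m" for i
    using Suc.prems[of "i # _"] that by (intro Suc.IH) simp_all
  then show ?case using Suc.prems[of "[]"] by simp
qed

lemma stop_mean_const: "stop_mean S (\<lambda>_. c) u T = c"
  by (induction T arbitrary: u) (simp_all add: sum_p flip: sum_distrib_right)

lemma stop_mean_nonneg: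
  assumes "\<And>v. 0 \<le> G v"
  shows "0 \<le> stop_mean S G u T"
  using stop_mean_mono[of "\<lambda>_. 0" u G S T] assms by (simp add: stop_mean_const)

lemma stop_mean_add: "stop_mean S (\<lambda>v. G v + G' v) u T = stop_mean S G u T + stop_mean S G' u T"
  by (simp add: sum_stop_tree[symmetric] distrib_left sum.distrib)

lemma stop_mean_diff: "stop_mean S (\<lambda>v. G v - G' v) u T = stop_mean S G u T - stop_mean S G' u T"
  by (simp add: sum_stop_tree[symmetric] right_diff_distrib sum_subtractf)

lemma stop_mean_cmult: "stop_mean S (\<lambda>v. c * G v) u T = c * stop_mean S G u T"
  by (simp add: sum_stop_tree[symmetric] sum_distrib_left mult_ac)

text \<open>Optional stopping for a bounded stopping time: each unfolding of the recursion preserves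
  the value of a harmonic \<open>G\<close>.\<close>

lemma stop_mean_martingale:
  assumes "\<And>v. G v = (\<Sum>i<m. p i * G (v @ [i]))"
  shows "stop_mean S G u T = G u"
  by (induction T arbitrary: u) (simp_all flip: assms)

text \<open>Markov property: as no stop is possible during the first \<open>t\<close> symbols, they
  are read unconditionally and the rule restarts from the word reached.\<close>

lemma stop_mean_split:
  assumes "\<And>v. length v < length u + t \<Longrightarrow> \<not> S v"
  shows "stop_mean S G u (t + T) = mean (\<lambda>v. stop_mean S G v T) u t"
  using assms
proof (induction t arbitrary: u)
  case (Suc t)
  have "stop_mean S G (u @ [i]) (t + T) = mean (\<lambda>v. stop_mean S G v T) (u @ [i]) t" for i
    using Suc.prems by (intro Suc.IH) simp
  then show ?case using Suc.prems[of u] by simp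
qed simp

lemma mean_ge_word:
  assumes "\<And>v. f v \<ge> 0" and "w \<in> lists {..<m}"
  shows "mean f u (length w) \<ge> word_prob p w * f (u @ w)"
  using assms(2)
proof (induction w arbitrary: u)
  case Nil
  then show ?case by (simp add: word_prob_def)
next
  case (Cons i w)
  have "word_prob p (i # w) * f (u @ i # w) = p i * (word_prob p w * f ((u @ [i]) @ w))"
    by (simp add: word_prob_def)
  also have "\<dots> \<le> p i * mean f (u @ [i]) (length w)"
    using Cons.hyps p_nonneg by (intro mult_left_mono Cons.IH) auto
  also have "\<dots> \<le> (\<Sum>j<m. p j * mean f (u @ [j]) (length w))"
    using Cons.hyps p_nonneg assms(1)
    by (intro member_le_sum) (auto intro!: mult_nonneg_nonneg stop_mean_nonneg)
  finally show ?case by simp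
qed

subsection \<open>Waiting times\<close>

abbreviation missed :: "(nat list \<Rightarrow> bool) \<Rightarrow> nat list \<Rightarrow> nat \<Rightarrow> real" where
  "missed S \<equiv> stop_mean S (\<lambda>v. if S v then 0 else 1)"

abbreviation extra_length :: "(nat list \<Rightarrow> bool) \<Rightarrow> nat list \<Rightarrow> nat \<Rightarrow> real" where
  "extra_length S u T \<equiv> stop_mean S (\<lambda>v. real (length v)) u T - real (length u)"

lemma missed_nonneg: "0 \<le> missed S u T"
  by (rule stop_mean_nonneg) simp

lemma missed_le_1: "missed S u T \<le> 1"
  using stop_mean_mono[of "\<lambda>v. if S v then 0 else 1" u "\<lambda>_. 1"] by (simp add: stop_mean_const)

lemma missed_stop: "S u \<Longrightarrow> missed S u T = 0"
  by (cases T) simp_all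

lemma missed_mono: "missed S u (T + k) \<le> missed S u T"
proof (induction T arbitrary: u)
  case 0
  then show ?case using missed_le_1 missed_stop by simp
next
  case (Suc T)
  then show ?case by (auto intro!: sum_mono mult_left_mono p_nonneg)
qed

text \<open>Only an inequality: on the right the first \<open>t\<close> symbols are read even if
  \<open>S\<close> held on the way, whereas on the left such a word already contributes
  zero.\<close>

lemma missed_split: "missed S u (t + T) \<le> mean (\<lambda>v. missed S v T) u t"
proof (induction t arbitrary: u)
  case (Suc t)
  have nonneg: "mean (\<lambda>v. missed S v T) v t \<ge> 0" for v
    by (intro stop_mean_nonneg missed_nonneg)
  show ?case
    using Suc nonneg by (auto intro!: sum_mono mult_left_mono p_nonneg sum_nonneg mult_nonneg_nonneg)
qed simp

lemma extra_length_stop: "S u \<Longrightarrow> extra_length S u T = 0"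
  by (cases T) simp_all

lemma extra_length_Suc:
  assumes "\<not> S u"
  shows "extra_length S u (Suc T) = 1 + (\<Sum>i<m. p i * extra_length S (u @ [i]) T)"
  using assms by (simp add: right_diff_distrib sum_subtractf sum_p flip: sum_distrib_right)

lemma extra_length_nonneg: "0 \<le> extra_length S u T"
  using stop_mean_mono[of "\<lambda>_. real (length u)" u "\<lambda>v. real (length v)"]
  by (simp add: stop_mean_const)

lemma extra_length_split:
  "extra_length S u (t + T) \<le> real t + mean (\<lambda>v. extra_length S v T) u t"
proof (induction t arbitrary: u)
  case (Suc t)
  have nonneg: "mean (\<lambda>v. extra_length S v T) v t \<ge> 0" for v t
    by (intro stop_mean_nonneg extra_length_nonneg)
  show ?case
  proof (cases "S u")
    case True
    then show ?thesis using extra_length_stop[of S u "Suc t + T"] nonneg[of u "Suc t"]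
      by (simp del: stop_mean.simps)
  next
    case False
    have "extra_length S u (Suc (t + T)) = 1 + (\<Sum>i<m. p i * extra_length S (u @ [i]) (t + T))"
      using False by (rule extra_length_Suc)
    also have "(\<Sum>i<m. p i * extra_length S (u @ [i]) (t + T))
        \<le> (\<Sum>i<m. p i * (real t + mean (\<lambda>v. extra_length S v T) (u @ [i]) t))"
      by (intro sum_mono mult_left_mono Suc p_nonneg) simp
    also have "\<dots> = real t + mean (\<lambda>v. extra_length S v T) u (Suc t)"
      by (simp add: distrib_left sum.distrib sum_p flip: sum_distrib_right)
    finally show ?thesis by simp
  qed
qed simp

context
  fixes S :: "nat list \<Rightarrow> bool" and N L :: nat and b :: real
  assumes b: "0 < b" "b \<le> 1"
    and hit: "\<And>u. u \<in> lists {..<m} \<Longrightarrow> length u \<ge> N \<Longrightarrow>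
      \<exists>t. 1 \<le> t \<and> t \<le> L \<and> b \<le> mean (\<lambda>v. if S v then 1 else 0) u t"
begin

text \<open>Whatever was read before, each further block of \<open>L\<close> symbols contains a time
  at which \<open>S\<close> holds with probability at least \<open>b\<close>, so \<open>K\<close>
  blocks fail with probability at most \<open>(1 - b) ^ K\<close>.\<close>

lemma missed_le_power:
  "u \<in> lists {..<m} \<Longrightarrow> length u \<ge> N \<Longrightarrow> missed S u (K * L) \<le> (1 - b) ^ K"
proof (induction K arbitrary: u)
  case 0
  then show ?case by simp
next
  case (Suc K)
  obtain t where t: "1 \<le> t" "t \<le> L" "b \<le> mean (\<lambda>v. if S v then 1 else 0) u t"
    using hit Suc.prems by blast
  \<comment> \<open>The time \<open>t\<close> depends on \<open>u\<close>; the \<open>L - t\<close>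
    symbols left in the block are given away by \<open>missed_mono\<close>.\<close>
  have "missed S u (Suc K * L) = missed S u ((t + K * L) + (L - t))"
    using t(2) by (simp add: algebra_simps)
  also have "\<dots> \<le> missed S u (t + K * L)" by (rule missed_mono)
  also have "\<dots> \<le> mean (\<lambda>v. missed S v (K * L)) u t" by (rule missed_split)
  also have "\<dots> \<le> mean (\<lambda>v. (1 - b) ^ K * (1 - (if S v then 1 else 0))) u t"
  proof (rule stop_mean_mono)
    fix w assume "w \<in> lists {..<m}"
    then have "missed S (u @ w) (K * L) \<le> (1 - b) ^ K" using Suc.prems by (intro Suc.IH) auto
    then show "missed S (u @ w) (K * L) \<le> (1 - b) ^ K * (1 - (if S (u @ w) then 1 else 0))"
      using missed_stop by simp
  qed
  also have "\<dots> = (1 - b) ^ K * (1 - mean (\<lambda>v. if S v then 1 else 0) u t)"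
    by (simp add: stop_mean_cmult stop_mean_diff stop_mean_const)
  also have "\<dots> \<le> (1 - b) ^ K * (1 - b)"
    using t(3) b by (intro mult_left_mono) auto
  finally show ?case by (simp add: mult.commute)
qed

text \<open>Comparison with a geometric waiting time: a bound \<open>B\<close> reproduces itself
  when \<open>L + (1 - b) * B \<le> B\<close>, and \<open>B = L / b\<close> gives equality. The
  induction runs over the horizon, which shrinks because \<open>t \<ge> 1\<close>; the bound does
  not depend on it.\<close>

lemma extra_length_le:
  "u \<in> lists {..<m} \<Longrightarrow> length u \<ge> N \<Longrightarrow> extra_length S u T \<le> L / b"
proof (induction T arbitrary: u rule: less_induct)
  case (less T)
  obtain t where t: "1 \<le> t" "t \<le> L" "b \<le> mean (\<lambda>v. if S v then 1 else 0) u t"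
    using hit less.prems by blast
  have L_le: "real L \<le> L / b" using b by (simp add: field_simps mult_left_le_one_le)
  show ?case
  proof (cases "t \<le> T")
    case False
    have "extra_length S u (T + 0) \<le> real T + mean (\<lambda>v. extra_length S v 0) u T"
      by (rule extra_length_split)
    also have "\<dots> = real T" by (simp add: stop_mean_const)
    finally show ?thesis using False t(2) L_le by simp
  next
    case True
    have "extra_length S u T \<le> real t + mean (\<lambda>v. extra_length S v (T - t)) u t"
      using extra_length_split[of S u t "T - t"] True by simp
    also have "mean (\<lambda>v. extra_length S v (T - t)) u t
        \<le> mean (\<lambda>v. L / b * (1 - (if S v then 1 else 0))) u t"
    proof (rule stop_mean_mono)
      fix w assume "w \<in> lists {..<m}"
      then have "extra_length S (u @ w) (T - t) \<le> L / b"
        using less.prems t(1) True by (intro less.IH) auto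
      then show "extra_length S (u @ w) (T - t) \<le> L / b * (1 - (if S (u @ w) then 1 else 0))"
        using extra_length_stop[of S "u @ w" "T - t"] by simp
    qed
    also have "\<dots> = L / b * (1 - mean (\<lambda>v. if S v then 1 else 0) u t)"
      by (simp only: stop_mean_cmult stop_mean_diff stop_mean_const)
    also have "\<dots> \<le> L / b * (1 - b)"
      using t(3) b by (intro mult_left_mono) auto
    also have "real t + L / b * (1 - b) \<le> L / b"
      using t(2) b by (simp add: field_simps)
    finally show ?thesis by simp
  qed
qed

end

end

section \<open>From hitting probabilities to codes\<close>

text \<open>\<open>up\<close> tells on which side of \<open>x\<close> the integer lies. The side
  matters because rounding up lowers the Kraft sum and rounding down raises it.\<close>

definition near_int :: "real \<Rightarrow> bool \<Rightarrow> real \<Rightarrow> bool" where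
  "near_int e up x \<longleftrightarrow> (\<exists>z::int. if up then 0 \<le> z - x \<and> z - x \<le> e else 0 \<le> x - z \<and> x - z \<le> e)"

text \<open>The default is the ceiling, also on the lower side when no integer is close enough
  below; a word truncated without a hit is thus rounded in the direction that is safe for the Kraft
  sum.\<close>

definition rounded :: "real \<Rightarrow> bool \<Rightarrow> real \<Rightarrow> int" where
  "rounded e up x = (if \<not> up \<and> near_int e False x then \<lfloor>x\<rfloor> else \<lceil>x\<rceil>)"

lemma rounded_near:
  assumes "near_int e up x"
  shows "\<bar>real_of_int (rounded e up x) - x\<bar> \<le> e"
proof -
  obtain z :: int where z: "if up then 0 \<le> z - x \<and> z - x \<le> e else 0 \<le> x - z \<and> x - z \<le> e"
    using assms unfolding near_int_def by blast
  show ?thesis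
  proof (cases up)
    case True
    then have "\<lceil>x\<rceil> \<le> z" using z by (simp add: ceiling_le_iff)
    then have "real_of_int \<lceil>x\<rceil> \<le> z" by (simp only: of_int_le_iff)
    moreover have "x \<le> of_int \<lceil>x\<rceil>" by (rule le_of_int_ceiling)
    ultimately show ?thesis using z True by (simp add: rounded_def)
  next
    case False
    then have "z \<le> \<lfloor>x\<rfloor>" using z by (simp add: le_floor_iff)
    then have "of_int z \<le> real_of_int \<lfloor>x\<rfloor>" by (simp only: of_int_le_iff)
    moreover have "of_int \<lfloor>x\<rfloor> \<le> x" by (rule of_int_floor_le)
    ultimately show ?thesis using z False assms by (simp add: rounded_def)
  qed
qed

lemma abs_rounded_diff_le_1: "\<bar>real_of_int (rounded e up x) - x\<bar> \<le> 1"
  unfolding rounded_def by (cases "\<not> up \<and> near_int e False x") (simp, linarith)+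

lemma rounded_up: "x \<le> real_of_int (rounded e True x)"
  unfolding rounded_def by simp

lemma rounded_down: "near_int e False x \<Longrightarrow> real_of_int (rounded e False x) \<le> x"
  unfolding rounded_def by simp

lemma rounded_nonneg: "0 \<le> x \<Longrightarrow> 0 \<le> rounded e up x"
  unfolding rounded_def by simp

text \<open>A discrete intermediate value argument: elements are switched from \<open>x\<close> to
  \<open>y\<close> one at a time until the sum reaches \<open>1 - \<eta>\<close>. A single switch
  adds at most \<open>\<eta>\<close>, so the sum never passes \<open>1\<close>.\<close>

lemma balanced_subset:
  fixes x y :: "'a \<Rightarrow> real"
  assumes "finite U" and "\<And>u. u \<in> U \<Longrightarrow> y u - x u \<le> \<eta>" and "(\<Sum>u\<in>U. x u) \<le> 1"
  shows "\<exists>A\<subseteq>U. (\<Sum>u\<in>U. if u \<in> A then y u else x u) \<le> 1 \<and>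
    (A = U \<or> 1 - \<eta> \<le> (\<Sum>u\<in>U. if u \<in> A then y u else x u))"
proof -
  define k where "k A = (\<Sum>u\<in>U. if u \<in> A then y u else x u)" for A
  have k_insert: "k (insert a A) \<le> k A + \<eta>" if "a \<in> U" "a \<notin> A" for a A
  proof -
    have "k (insert a A) = y a + (\<Sum>u\<in>U - {a}. if u \<in> A then y u else x u)"
      unfolding k_def using that assms(1) by (subst sum.remove[of U a]) (auto intro!: sum.cong)
    moreover have "k A = x a + (\<Sum>u\<in>U - {a}. if u \<in> A then y u else x u)"
      unfolding k_def using that assms(1) by (subst sum.remove[of U a]) (auto intro!: sum.cong)
    ultimately show ?thesis using assms(2)[OF that(1)] by linarith
  qed
  have "\<exists>A\<subseteq>B. k A \<le> 1 \<and> (A = B \<or> 1 - \<eta> \<le> k A)" if "finite B" "B \<subseteq> U" for B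
    using that
  proof (induction B rule: finite_induct)
    case empty
    then show ?case using assms(3) by (intro exI[of _ "{}"]) (simp add: k_def)
  next
    case (insert a B)
    then obtain A where A: "A \<subseteq> B" "k A \<le> 1" "A = B \<or> 1 - \<eta> \<le> k A" by auto
    show ?case
    proof (cases "1 - \<eta> \<le> k A")
      case True
      then show ?thesis using A by (intro exI[of _ A]) auto
    next
      case False
      have "k (insert a A) \<le> k A + \<eta>" using insert A by (intro k_insert) auto
      then show ?thesis using False A by (intro exI[of _ "insert a A"]) auto
    qed
  qed
  from this[of U] show ?thesis using assms(1) unfolding k_def by simp
qed

lemma exp_le_quadratic:
  fixes y :: real
  assumes "\<bar>y\<bar> \<le> B"
  shows "exp y \<le> 1 + y + exp B / 2 * y\<^sup>2"
proof -
  obtain t where t: "\<bar>t\<bar> \<le> \<bar>y\<bar>" "exp y = (\<Sum>k<2. y ^ k / fact k) + exp t / fact 2 * y ^ 2"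
    using Maclaurin_exp_le by blast
  have "exp t * y\<^sup>2 \<le> exp B * y\<^sup>2" using t(1) assms by (intro mult_right_mono) auto
  then show ?thesis using t(2) by (simp add: numeral_2_eq_2)
qed

section \<open>Symbol costs, phases, and the code obtained from a stopping rule\<close>

locale bernoulli_coding = bernoulli_source +
  fixes n :: nat
  assumes n_ge_2: "n \<ge> 2"
begin

definition cost :: "nat \<Rightarrow> real" where
  "cost i = - log n (p i)"

definition phase :: "nat list \<Rightarrow> real" where
  "phase w = sum_list (map cost w)"

lemma phase_append [simp]: "phase (v @ w) = phase v + phase w"
  by (simp add: phase_def)

lemma phase_single [simp]: "phase [i] = cost i"
  by (simp add: phase_def)

lemma p_less_1:
  assumes "i < m"
  shows "p i < 1"
proof -
  define j where "j = (if i = 0 then 1 else 0 :: nat)"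
  have j: "j < m" "j \<noteq> i" using m_ge_2 by (auto simp: j_def)
  have "p i + p j = (\<Sum>k\<in>{i, j}. p k)" using j by simp
  also have "\<dots> \<le> (\<Sum>k<m. p k)" using assms j p_nonneg by (intro sum_mono2) auto
  finally show ?thesis using p_pos[OF j(1)] sum_p by simp
qed

lemma phase_nonneg: "w \<in> lists {..<m} \<Longrightarrow> 0 \<le> phase w"
proof (induction w)
  case (Cons i w)
  have "log n (p i) \<le> 0" using Cons.prems p_pos p_less_1 n_ge_2 by (simp add: less_imp_le)
  then show ?case using Cons by (simp add: phase_def cost_def)
qed (simp add: phase_def)

lemma word_prob_phase: "w \<in> lists {..<m} \<Longrightarrow> word_prob p w = n powr - phase w"
proof (induction w)
  case (Cons i w)
  have "p i = n powr - cost i" using Cons.prems p_pos[of i] n_ge_2 by (simp add: cost_def)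
  then show ?case using Cons by (simp add: word_prob_def phase_def powr_add[symmetric])
qed (use n_ge_2 in \<open>simp add: phase_def word_prob_def\<close>)

lemma mean_cost: "(\<Sum>i<m. p i * cost i) = entropy m p / log 2 n"
proof -
  have "p i * cost i = - (p i * log 2 (p i)) / log 2 n" if "i < m" for i
    unfolding cost_def using n_ge_2 by (simp add: log_base_change[of 2 n])
  then show ?thesis by (simp add: entropy_def sum_negf flip: sum_divide_distrib)
qed

text \<open>Wald's identity: phase minus entropy times length is a martingale. Hence the ideal code
  length averages exactly to entropy times delay, and only rounding contributes to the
  redundancy.\<close>

lemma stop_mean_phase:
  "stop_mean S phase u T - phase u = entropy m p / log 2 n * extra_length S u T"
proof -
  define h where "h = entropy m p / log 2 n"
  have "stop_mean S (\<lambda>v. phase v - h * length v) u T = phase u - h * length u"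
  proof (rule stop_mean_martingale)
    fix v :: "nat list"
    have "(\<Sum>i<m. p i * (phase (v @ [i]) - h * length (v @ [i]))) =
      (\<Sum>i<m. p i * (phase v - h * length v - h) + p i * cost i)"
      by (intro sum.cong) (simp_all add: algebra_simps)
    also have "\<dots> = phase v - h * length v"
      by (simp add: sum.distrib mean_cost h_def sum_p flip: sum_distrib_right)
    finally show "phase v - h * length v = (\<Sum>i<m. p i * (phase (v @ [i]) - h * length (v @ [i])))" ..
  qed
  then have "stop_mean S phase u T - h * stop_mean S (\<lambda>v. real (length v)) u T = phase u - h * length u"
    unfolding stop_mean_diff stop_mean_cmult .
  then show ?thesis unfolding h_def[symmetric] by (simp add: right_diff_distrib)
qed

text \<open>
  The first \<open>T0\<close> symbols of a codeword are read unconditionally; they determine on which side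
  its phase has to approach an integer. Choosing the sides so that the Kraft sum is close to
  \<open>1\<close> cancels the rounding errors to first order.
\<close>

lemma code_of_hitting_bound:
  fixes e b \<rho> :: real and L K T0 :: nat
  assumes e: "0 \<le> e" and b: "0 < b" "b \<le> 1" and T0: "T0 \<ge> 1"
    and hit: "\<And>u up. u \<in> lists {..<m} \<Longrightarrow>
      \<exists>t. 1 \<le> t \<and> t \<le> L \<and> b \<le> mean (\<lambda>v. if near_int e up (phase v) then 1 else 0) u t"
    and \<rho>: "\<And>i. i < m \<Longrightarrow> p i \<le> \<rho>"
  shows "\<exists>W \<phi>. word_based_code m n W \<phi> \<and> decipherable W \<phi> \<and>
    T0 \<le> avg_delay p W \<and> avg_delay p W \<le> T0 + L / b \<and> max_delay W \<le> T0 + K * L \<and>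
    redundancy m n p W \<phi> \<le>
      (n / ln n + n * ln n) * (e\<^sup>2 + (1 - b) ^ K + \<rho> ^ T0) / avg_delay p W"
proof -
  define near where "near up v \<longleftrightarrow> near_int e up (phase v)" for up v
  define excess where "excess up v = rounded e up (phase v) - phase v" for up v
  \<comment> \<open>The Kraft sum of the subtree below \<open>u\<close>, divided by the probability
    of \<open>u\<close>, if all its words are rounded on the side \<open>up\<close>.\<close>
  define k where "k up u = stop_mean (near up) (\<lambda>v. n powr - excess up v) u (K * L)" for up u
  define U where "U = stop_tree (\<lambda>_. False) [] T0"
  have n: "real n > 1" "ln n > 0" using n_ge_2 by auto
  have powr_le_1: "n powr x \<le> 1" if "x \<le> 0" for x
    using powr_mono[OF that, of "real n"] n by simp
  have powr_ge_1: "1 \<le> n powr x" if "0 \<le> x" for x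
    using powr_mono[OF that, of "real n"] n by simp
  have finU: "finite U" unfolding U_def by (rule finite_stop_tree)
  have U: "u \<in> lists {..<m}" "length u = T0" if "u \<in> U" for u
    using that stop_tree_lists length_stop_tree length_stop_tree_ge[of u _ "[]" T0 0]
    unfolding U_def by (auto intro!: le_antisym)
  have mean_U: "mean f [] T0 = (\<Sum>u\<in>U. word_prob p u * f u)" for f
    unfolding U_def using sum_stop_tree[of f "[]" "\<lambda>_. False" T0] by simp
  have prob_U: "word_prob p u \<le> \<rho> ^ T0" if "u \<in> U" for u
  proof -
    have "word_prob p w \<le> \<rho> ^ length w" if "w \<in> lists {..<m}" for w
      using that
    proof (induction w)
      case (Cons i w)
      then have "p i * word_prob p w \<le> \<rho> * \<rho> ^ length w"
        using \<rho>[of i] p_nonneg[of i] by (intro mult_mono word_prob_nonneg) auto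
      then show ?case by (simp add: word_prob_def)
    qed (simp add: word_prob_def)
    then show ?thesis using U[OF that] by metis
  qed
  have P_nonneg: "0 \<le> word_prob p u" if "u \<in> U" for u using U that word_prob_nonneg by blast
  have sum_U: "(\<Sum>u\<in>U. word_prob p u) = 1" using mean_U[of "\<lambda>_. 1"] by (simp add: stop_mean_const)
  have k_nonneg: "0 \<le> k up u" for up u unfolding k_def by (rule stop_mean_nonneg) simp
  have k_up: "k True u \<le> 1" for u
  proof -
    have "k True u \<le> stop_mean (near True) (\<lambda>_. 1) u (K * L)"
      unfolding k_def excess_def using rounded_up by (intro stop_mean_mono powr_le_1) simp
    then show ?thesis by (simp add: stop_mean_const)
  qed
  have k_le: "k up u \<le> n" for up u
  proof -
    have "n powr - excess up v \<le> n powr 1" for v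
      using abs_rounded_diff_le_1[of e up "phase v"] n unfolding excess_def
      by (intro powr_mono) auto
    then have "k up u \<le> stop_mean (near up) (\<lambda>_. n) u (K * L)"
      unfolding k_def using n by (intro stop_mean_mono) simp
    then show ?thesis by (simp add: stop_mean_const)
  qed
  \<comment> \<open>A word that hits from above an integer is rounded down and contributes at least
    its probability; the others contribute at least zero.\<close>
  have k_down: "1 - (1 - b) ^ K \<le> k False u" if "u \<in> U" for u
  proof -
    have "missed (near False) u (K * L) \<le> (1 - b) ^ K"
      by (rule missed_le_power[OF b, where N = 0]) (use hit U(1)[OF that] in \<open>auto simp: near_def\<close>)
    then have "1 - (1 - b) ^ K \<le> stop_mean (near False) (\<lambda>v. 1 - (if near False v then 0 else 1)) u (K * L)"
      by (simp add: stop_mean_diff stop_mean_const)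
    also have "\<dots> \<le> k False u"
      unfolding k_def
    proof (rule stop_mean_mono)
      fix w
      show "1 - (if near False (u @ w) then 0 else 1) \<le> n powr - excess False (u @ w)"
        using rounded_down[of e "phase (u @ w)"] unfolding near_def excess_def by (auto intro!: powr_ge_1)
    qed
    finally show ?thesis .
  qed
  have side: "(if u \<in> A then word_prob p u * k False u else word_prob p u * k True u) =
    word_prob p u * k (u \<notin> A) u" for u A by simp
  \<comment> \<open>With every side up the Kraft sum is at most \<open>1\<close>. Switching one
    initial word changes it by at most \<open>\<rho> ^ T0 * n\<close>, since excesses are bounded by
    \<open>1\<close> and initial words have probability at most \<open>\<rho> ^ T0\<close>.\<close>
  have "\<exists>A\<subseteq>U. (\<Sum>u\<in>U. if u \<in> A then word_prob p u * k False u else word_prob p u * k True u) \<le> 1 \<and>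
    (A = U \<or> 1 - \<rho> ^ T0 * n \<le> (\<Sum>u\<in>U. if u \<in> A then word_prob p u * k False u else word_prob p u * k True u))"
  proof (rule balanced_subset[OF finU])
    fix u assume u: "u \<in> U"
    have "word_prob p u * k False u \<le> \<rho> ^ T0 * n"
      using u prob_U[OF u] k_le k_nonneg P_nonneg[OF u] by (intro mult_mono) auto
    moreover have "0 \<le> word_prob p u * k True u" using P_nonneg[OF u] k_nonneg by simp
    ultimately show "word_prob p u * k False u - word_prob p u * k True u \<le> \<rho> ^ T0 * n" by linarith
  next
    have "(\<Sum>u\<in>U. word_prob p u * k True u) \<le> (\<Sum>u\<in>U. word_prob p u)"
      using P_nonneg k_up by (intro sum_mono mult_left_le) auto
    then show "(\<Sum>u\<in>U. word_prob p u * k True u) \<le> 1" using sum_U by simp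
  qed
  then obtain A where A: "A \<subseteq> U" "(\<Sum>u\<in>U. word_prob p u * k (u \<notin> A) u) \<le> 1"
    "A = U \<or> 1 - \<rho> ^ T0 * n \<le> (\<Sum>u\<in>U. word_prob p u * k (u \<notin> A) u)"
    unfolding side by blast
  \<comment> \<open>The side depends on the first \<open>T0\<close> symbols only, so it is fixed
    before any stop can occur; \<open>A\<close> collects the initial words whose extensions aim at
    rounding down.\<close>
  define up where "up v \<longleftrightarrow> take T0 v \<notin> A" for v
  define S where "S v \<longleftrightarrow> length v \<ge> T0 \<and> near (up v) v" for v
  define len where "len v = nat (rounded e (up v) (phase v))" for v
  define W where "W = stop_tree S [] (T0 + K * L)"
  have up_ext: "up (u @ v) = up u" if "length u \<ge> T0" for u v using that by (simp add: up_def)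
  have hit_S: "\<exists>t. 1 \<le> t \<and> t \<le> L \<and> b \<le> mean (\<lambda>v. if S v then 1 else 0) u t"
    if u: "u \<in> lists {..<m}" "length u \<ge> T0" for u
  proof -
    obtain t where t: "1 \<le> t" "t \<le> L" "b \<le> mean (\<lambda>v. if near (up u) v then 1 else 0) u t"
      using hit[OF u(1), of "up u"] unfolding near_def by blast
    have "mean (\<lambda>v. if near (up u) v then 1 else 0) u t = mean (\<lambda>v. if S v then 1 else 0) u t"
      by (rule stop_mean_cong) (use u(2) up_ext in \<open>auto simp: S_def\<close>)
    then show ?thesis using t by auto
  qed
  have kraft_eq: "stop_mean S (\<lambda>v. n powr - excess (up v) v) [] (T0 + K * L) =
      (\<Sum>u\<in>U. word_prob p u * k (u \<notin> A) u)"
  proof -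
    have "stop_mean S (\<lambda>v. n powr - excess (up v) v) u (K * L) = k (u \<notin> A) u" if "u \<in> U" for u
      unfolding k_def using U[OF that] up_ext[of u]
      by (intro stop_mean_cong) (auto simp: S_def up_def)
    then have "mean (\<lambda>u. stop_mean S (\<lambda>v. n powr - excess (up v) v) u (K * L)) [] T0 =
        (\<Sum>u\<in>U. word_prob p u * k (u \<notin> A) u)"
      unfolding mean_U by (intro sum.cong) auto
    then show ?thesis using stop_mean_split[of "[]" T0 S] unfolding S_def by simp
  qed
  have missed_S: "missed S [] (T0 + K * L) \<le> (1 - b) ^ K"
  proof -
    have "missed S [] (T0 + K * L) \<le> mean (\<lambda>v. missed S v (K * L)) [] T0" by (rule missed_split)
    also have "\<dots> \<le> mean (\<lambda>_. (1 - b) ^ K) [] T0"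
    proof (rule stop_mean_mono_tree)
      fix u assume "u \<in> stop_tree (\<lambda>_. False) [] T0"
      then show "missed S ([] @ u) (K * L) \<le> (1 - b) ^ K"
        using missed_le_power[OF b hit_S, where u = u and K = K] U[of u] by (simp add: U_def)
    qed
    finally show ?thesis by (simp add: stop_mean_const)
  qed
  have finW: "finite W" unfolding W_def by (rule finite_stop_tree)
  have W: "w \<in> lists {..<m}" "length w \<le> T0 + K * L" "T0 \<le> length w" if "w \<in> W" for w
    using that stop_tree_lists length_stop_tree length_stop_tree_ge[of w S "[]" T0 "K * L"]
    unfolding W_def by (auto simp: S_def)
  have mean_W: "stop_mean S f [] (T0 + K * L) = (\<Sum>w\<in>W. word_prob p w * f w)" for f
    unfolding W_def using sum_stop_tree[of f "[]" S "T0 + K * L"] by simp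
  have sum_W: "(\<Sum>w\<in>W. word_prob p w) = 1" using mean_W[of "\<lambda>_. 1"] by (simp add: stop_mean_const)
  have PW_nonneg: "0 \<le> word_prob p w" if "w \<in> W" for w using W that word_prob_nonneg by blast
  have Wne: "[] \<notin> W" using W(3) T0 by fastforce
  have pfW: "v = w" if "v \<in> W" "w \<in> W" "prefix v w" for v w
    using that stop_tree_prefix_free unfolding W_def by blast
  have completeW: "\<exists>k. stake k x \<in> W" if "x \<in> streams {..<m}" for x
    using that stop_tree_complete unfolding W_def by blast
  have len_eq: "real (len w) = phase w + excess (up w) w" if "w \<in> W" for w
    using rounded_nonneg[OF phase_nonneg[OF W(1)[OF that]]] by (simp add: len_def excess_def)
  have "1 / real n ^ len w = word_prob p w * n powr - excess (up w) w" if "w \<in> W" for w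
  proof -
    have "1 / real n ^ len w = n powr - real (len w)"
      using n by (simp add: powr_minus_divide powr_realpow)
    also have "\<dots> = n powr (- phase w + - excess (up w) w)" using len_eq[OF that] by simp
    also have "\<dots> = word_prob p w * n powr - excess (up w) w"
      unfolding powr_add word_prob_phase[OF W(1)[OF that]] ..
    finally show ?thesis .
  qed
  \<comment> \<open>The Kraft sum of the lengths is the expectation of
    \<open>n powr - excess\<close>, which the choice of \<open>A\<close> controls.\<close>
  then have "(\<Sum>w\<in>W. 1 / real n ^ len w) = stop_mean S (\<lambda>v. n powr - excess (up v) v) [] (T0 + K * L)"
    unfolding mean_W by (intro sum.cong) auto
  then have "(\<Sum>w\<in>W. 1 / real n ^ len w) \<le> 1" using kraft_eq A(2) by simp
  then obtain \<phi> where \<phi>: "\<forall>w\<in>W. \<phi> w \<in> lists {..<n} \<and> length (\<phi> w) = len w"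
    "\<forall>v\<in>W. \<forall>w\<in>W. prefix (\<phi> v) (\<phi> w) \<longrightarrow> v = w"
    using kraft_converse[OF finW, of n len] n_ge_2 by auto
  have code: "word_based_code m n W \<phi>"
    unfolding word_based_code_def
    using finW W(1) Wne \<phi>(1) unique_flat_if_prefix_free[OF pfW Wne _ completeW] by auto
  \<comment> \<open>An empty codeword is a prefix of every other, which forces
    \<open>W = {w}\<close>. But the constant messages of \<open>0\<close> and of \<open>1\<close>
    both begin with a word of \<open>W\<close>, so \<open>w\<close> would be empty.\<close>
  have \<phi>_ne: "\<phi> w \<noteq> []" if "w \<in> W" for w
  proof
    assume "\<phi> w = []"
    then have only: "v = w" if "v \<in> W" for v using \<phi>(2)[rule_format, of w v] \<open>w \<in> W\<close> that by simp
    have "sconst i \<in> streams {..<m}" if "i < m" for i using that by (simp add: streams_iff_snth)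
    then have stake: "\<exists>k. w = stake k (sconst i)" if "i < m" for i
      using that completeW[of "sconst i"] only by blast
    obtain k0 where "w = stake k0 (sconst 0)" using stake[of 0] m_ge_2 by auto
    moreover obtain k1 where "w = stake k1 (sconst 1)" using stake[of 1] m_ge_2 by auto
    moreover have "set (stake k (sconst i)) \<subseteq> {i}" for k and i :: nat
      by auto
    ultimately have "set w \<subseteq> {0}" "set w \<subseteq> {1}" by metis+
    then have "w = []" by (cases w) auto
    then show False using that Wne by simp
  qed
  have dec: "decipherable W \<phi>" by (rule decipherable_if_prefix_free[OF _ \<phi>_ne]) (use \<phi>(2) in blast)
  have D: "avg_delay p W = extra_length S [] (T0 + K * L)"
    unfolding avg_delay_def mean_W by simp
  have D_ge: "T0 \<le> avg_delay p W"
  proof -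
    have "T0 = (\<Sum>w\<in>W. word_prob p w * T0)" by (simp add: sum_W flip: sum_distrib_right)
    also have "\<dots> \<le> avg_delay p W"
      unfolding avg_delay_def using W(3) PW_nonneg by (intro sum_mono mult_left_mono) auto
    finally show ?thesis .
  qed
  have D_le: "avg_delay p W \<le> T0 + L / b"
  proof -
    have "avg_delay p W \<le> T0 + mean (\<lambda>v. extra_length S v (K * L)) [] T0"
      unfolding D by (rule extra_length_split)
    also have "mean (\<lambda>v. extra_length S v (K * L)) [] T0 \<le> mean (\<lambda>_. L / b) [] T0"
    proof (rule stop_mean_mono_tree)
      fix u assume "u \<in> stop_tree (\<lambda>_. False) [] T0"
      then show "extra_length S ([] @ u) (K * L) \<le> L / b"
        using extra_length_le[OF b hit_S, where u = u and T = "K * L"] U[of u] by (simp add: U_def)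
    qed
    finally show ?thesis by (simp add: stop_mean_const)
  qed
  have "W \<noteq> {}" using sum_W by auto
  then have max: "max_delay W \<le> T0 + K * L"
    unfolding max_delay_def using finW W(2) by simp
  define X where "X = (\<Sum>w\<in>W. word_prob p w * excess (up w) w)"
  have "(\<Sum>w\<in>W. word_prob p w * len w) = (\<Sum>w\<in>W. word_prob p w * phase w) + X"
    unfolding X_def sum.distrib[symmetric] by (intro sum.cong) (auto simp: len_eq algebra_simps)
  also have "(\<Sum>w\<in>W. word_prob p w * phase w) = entropy m p / log 2 n * avg_delay p W"
    using stop_mean_phase[of S "[]" "T0 + K * L"] unfolding D mean_W by (simp add: phase_def)
  finally have "redundancy m n p W \<phi> = X / avg_delay p W"
    using D_ge T0 \<phi>(1) unfolding redundancy_def by (simp add: add_divide_distrib)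
  moreover have "X \<le> (n / ln n + n * ln n) * (e\<^sup>2 + (1 - b) ^ K + \<rho> ^ T0)"
  proof -
    define c where "c = n / 2 * (ln n)\<^sup>2"
    have \<rho>_nonneg: "0 \<le> \<rho>" using \<rho>[of 0] p_nonneg[of 0] m_ge_2 by simp
    have b_nonneg: "0 \<le> (1 - b) ^ K" using b by simp
    \<comment> \<open>Either all initial words were switched and \<open>k_down\<close> applies to
      each, or the switching stopped because the sum was already close to \<open>1\<close>.\<close>
    have kraft_ge: "1 - (1 - b) ^ K - \<rho> ^ T0 * n \<le> (\<Sum>w\<in>W. word_prob p w * n powr - excess (up w) w)"
    proof -
      have "1 - (1 - b) ^ K - \<rho> ^ T0 * n \<le> (\<Sum>u\<in>U. word_prob p u * k (u \<notin> A) u)"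
      proof (cases "A = U")
        case True
        have "1 - (1 - b) ^ K = (\<Sum>u\<in>U. word_prob p u * (1 - (1 - b) ^ K))"
          by (simp add: sum_U flip: sum_distrib_right)
        also have "\<dots> \<le> (\<Sum>u\<in>U. word_prob p u * k (u \<notin> A) u)"
          using P_nonneg k_down True by (intro sum_mono mult_left_mono) auto
        finally show ?thesis using \<rho>_nonneg by (smt (verit) mult_nonneg_nonneg of_nat_0_le_iff zero_le_power)
      next
        case False
        then show ?thesis using A(3) b_nonneg by simp
      qed
      then show ?thesis using kraft_eq unfolding mean_W by simp
    qed
    \<comment> \<open>Second-order Taylor bound at exponent at most \<open>ln n\<close>, whence the
      factor \<open>n / 2 * (ln n)\<^sup>2\<close> in \<open>c\<close>. The squared excess is at
      most \<open>e\<^sup>2\<close> after a hit and at most \<open>1\<close> for a truncated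
      word.\<close>
    have pointwise: "n powr - excess (up w) w \<le>
        1 - ln n * excess (up w) w + c * (e\<^sup>2 + (if S w then 0 else 1))" if "w \<in> W" for w
    proof -
      define d where "d = excess (up w) w"
      have d1: "\<bar>d\<bar> \<le> 1" unfolding d_def excess_def by (rule abs_rounded_diff_le_1)
      have "d\<^sup>2 \<le> e\<^sup>2 + (if S w then 0 else 1)"
      proof (cases "S w")
        case True
        then have "\<bar>d\<bar> \<le> e" unfolding S_def near_def d_def excess_def using rounded_near by blast
        then show ?thesis using True by (simp add: abs_le_square_iff[symmetric])
      next
        case False
        then show ?thesis using d1 by (simp add: abs_square_le_1 add_increasing)
      qed
      then have "c * d\<^sup>2 \<le> c * (e\<^sup>2 + (if S w then 0 else 1))"
        unfolding c_def by (intro mult_left_mono) auto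
      moreover have "n powr - d \<le> 1 - ln n * d + c * d\<^sup>2"
      proof -
        have "\<bar>- d * ln n\<bar> \<le> ln n" using d1 n by (simp add: abs_mult mult_left_le_one_le)
        from exp_le_quadratic[OF this] show ?thesis
          using n by (simp add: powr_def c_def power_mult_distrib algebra_simps)
      qed
      ultimately show ?thesis unfolding d_def by linarith
    qed
    \<comment> \<open>Averaging the pointwise bound: since the Kraft sum is almost \<open>1\<close>,
      the constant terms cancel and the linear term \<open>ln n * X\<close> is bounded by
      second-order quantities.\<close>
    have "1 - (1 - b) ^ K - \<rho> ^ T0 * n \<le>
        (\<Sum>w\<in>W. word_prob p w * (1 - ln n * excess (up w) w + c * (e\<^sup>2 + (if S w then 0 else 1))))"
      using kraft_ge by (rule order_trans) (intro sum_mono mult_left_mono pointwise PW_nonneg)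
    also have "\<dots> = stop_mean S (\<lambda>w. 1 - ln n * excess (up w) w + c * (e\<^sup>2 + (if S w then 0 else 1))) [] (T0 + K * L)"
      by (rule mean_W[symmetric])
    also have "\<dots> = 1 - ln n * X + c * (e\<^sup>2 + missed S [] (T0 + K * L))"
      by (simp only: stop_mean_add stop_mean_diff stop_mean_cmult stop_mean_const) (simp add: mean_W X_def)
    also have "\<dots> \<le> 1 - ln n * X + c * (e\<^sup>2 + (1 - b) ^ K)"
      using missed_S by (intro add_left_mono mult_left_mono) (auto simp: c_def)
    finally have "ln n * X \<le> (1 - b) ^ K + \<rho> ^ T0 * n + c * (e\<^sup>2 + (1 - b) ^ K)" by simp
    also have "\<dots> \<le> n * (e\<^sup>2 + (1 - b) ^ K + \<rho> ^ T0) + n * (ln n)\<^sup>2 * (e\<^sup>2 + (1 - b) ^ K + \<rho> ^ T0)"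
    proof -
      have "(1 - b) ^ K \<le> n * (1 - b) ^ K" using mult_right_mono[of 1 "real n" "(1 - b) ^ K"] b_nonneg n by simp
      then have "(1 - b) ^ K + \<rho> ^ T0 * n \<le> n * (e\<^sup>2 + (1 - b) ^ K + \<rho> ^ T0)"
        by (simp add: distrib_left mult.commute add_increasing)
      moreover have "c * (e\<^sup>2 + (1 - b) ^ K) \<le> n * (ln n)\<^sup>2 * (e\<^sup>2 + (1 - b) ^ K + \<rho> ^ T0)"
        using b_nonneg \<rho>_nonneg unfolding c_def by (intro mult_mono) auto
      ultimately show ?thesis by linarith
    qed
    also have "\<dots> = ln n * ((n / ln n + n * ln n) * (e\<^sup>2 + (1 - b) ^ K + \<rho> ^ T0))"
      using n by (simp add: field_simps power2_eq_square)
    finally show ?thesis using n by (simp only: mult_le_cancel_left_pos)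
  qed
  ultimately have "redundancy m n p W \<phi> \<le>
      (n / ln n + n * ln n) * (e\<^sup>2 + (1 - b) ^ K + \<rho> ^ T0) / avg_delay p W"
    using D_ge T0 by (simp add: divide_right_mono)
  then show ?thesis using code dec D_ge D_le max by blast
qed

end

section \<open>Equidistribution\<close>

lemma near_int_uminus: "near_int e False x \<longleftrightarrow> near_int e True (- x)"
proof
  assume "near_int e False x"
  then obtain z :: int where "0 \<le> x - z \<and> x - z \<le> e" by (auto simp: near_int_def)
  then show "near_int e True (- x)" unfolding near_int_def by (intro exI[of _ "- z"]) simp
next
  assume "near_int e True (- x)"
  then obtain z :: int where "0 \<le> z - (- x) \<and> z - (- x) \<le> e" by (auto simp: near_int_def)
  then show "near_int e False x" unfolding near_int_def by (intro exI[of _ "- z"]) simp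
qed

lemma near_int_add_int:
  assumes "near_int e up x" and "d \<in> \<int>"
  shows "near_int e up (x + d)"
proof -
  obtain z :: int where z: "if up then 0 \<le> z - x \<and> z - x \<le> e else 0 \<le> x - z \<and> x - z \<le> e"
    using assms(1) unfolding near_int_def by blast
  obtain k :: int where "d = k" using assms(2) by (auto elim: Ints_cases)
  then show ?thesis unfolding near_int_def using z by (intro exI[of _ "z + k"]) auto
qed

lemma near_int_of_Ints: "x \<in> \<int> \<Longrightarrow> 0 \<le> e \<Longrightarrow> near_int e up x"
  unfolding near_int_def by (auto elim!: Ints_cases)

text \<open>Replace \<open>\<alpha>\<close> by \<open>h / q\<close>: as \<open>h\<close> is
  invertible modulo \<open>q\<close>, the \<open>q\<close> multiples reach every residue, so one
  lands just below an integer. The replacement moves the point by at most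
  \<open>1 / q\<close>.\<close>

lemma near_int_rotation_up:
  fixes \<alpha> x :: real and h q a :: int
  assumes q: "q > 0" and cop: "coprime h q" and approx: "\<bar>\<alpha> - h / q\<bar> \<le> 1 / q\<^sup>2"
  shows "\<exists>k. a \<le> k \<and> k < a + q \<and> near_int (3 / q) True (x + k * \<alpha>)"
proof -
  define y where "y = x + a * \<alpha>"
  \<comment> \<open>The extra \<open>1\<close> puts \<open>N / q\<close> between
    \<open>1 / q\<close> and \<open>2 / q\<close> above \<open>y\<close>, so a drift
    \<open>d\<close> of size \<open>1 / q\<close> in either direction leaves a distance between
    \<open>0\<close> and \<open>3 / q\<close>.\<close>
  define N where "N = \<lceil>q * y\<rceil> + 1"
  obtain u w where uw: "u * h + w * q = 1" using bezout_int[of h q] cop by auto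
  define k where "k = (- N * u) mod q"
  have k: "0 \<le> k" "k < q" using q by (simp_all add: k_def)
  define D where "D = (- N * u) div q"
  define z where "z = N * w - h * D"
  have "k = - N * u - q * D" unfolding k_def D_def by (rule minus_mult_div_eq_mod[symmetric])
  then have "h * k + N = N * (1 - u * h) - q * (h * D)" by (simp only:) (simp add: algebra_simps)
  also have "1 - u * h = w * q" using uw by simp
  finally have z: "h * k + N = q * z" by (simp add: z_def algebra_simps)
  have qr: "real_of_int q > 0" using q by simp
  have Nz: "real_of_int h * k + N = q * z" by (metis z of_int_add of_int_mult)
  have N: "q * y + 1 \<le> N" "N \<le> q * y + 2" unfolding N_def by linarith+
  define d where "d = k * (\<alpha> - h / q)"
  have d: "\<bar>d\<bar> \<le> 1 / q"
  proof -
    have "\<bar>d\<bar> \<le> q * (1 / q\<^sup>2)"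
      unfolding d_def abs_mult using k approx qr by (intro mult_mono) auto
    then show ?thesis using qr by (simp add: power2_eq_square)
  qed
  have "z - (y + k * \<alpha>) = N / q - y - d"
  proof -
    have "real_of_int z = (N + real_of_int h * k) / q" using Nz qr by (simp add: field_simps)
    then show ?thesis by (simp add: d_def algebra_simps add_divide_distrib)
  qed
  moreover have "1 / q \<le> N / q - y" "N / q - y \<le> 2 / q"
    using divide_right_mono[OF N(1), of q] divide_right_mono[OF N(2), of q] qr
    by (simp_all add: add_divide_distrib)
  moreover have "2 / q + 1 / q = 3 / real_of_int q" by (simp add: add_divide_distrib[symmetric])
  ultimately have "0 \<le> z - (y + k * \<alpha>) \<and> z - (y + k * \<alpha>) \<le> 3 / q" using d by linarith
  moreover have "y + k * \<alpha> = x + (a + k) * \<alpha>" by (simp add: y_def algebra_simps)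
  ultimately have "near_int (3 / q) True (x + (a + k) * \<alpha>)" unfolding near_int_def by auto
  then show ?thesis using k by (intro exI[of _ "a + k"]) auto
qed

lemma near_int_rotation:
  fixes \<alpha> x :: real and h q a :: int
  assumes q: "q > 0" and cop: "coprime h q" and approx: "\<bar>\<alpha> - h / q\<bar> \<le> 1 / q\<^sup>2"
  shows "\<exists>k. a \<le> k \<and> k < a + q \<and> near_int (3 / q) up (x + k * \<alpha>)"
proof (cases up)
  case True
  then show ?thesis using near_int_rotation_up[OF assms] by simp
next
  case False
  have "coprime (- h) q" using cop by simp
  moreover have "\<bar>- \<alpha> - (- h) / q\<bar> \<le> 1 / q\<^sup>2" using approx by (simp add: abs_minus_commute)
  ultimately show ?thesis
    using near_int_rotation_up[OF q, of "- h" "- \<alpha>" a "- x"] False by (simp add: near_int_uminus)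
qed

lemma irrational_approx:
  fixes \<alpha> :: real
  assumes "\<alpha> \<notin> \<rat>"
  shows "\<exists>h q. q > N \<and> q > 0 \<and> coprime h q \<and> \<bar>\<alpha> - h / of_int q\<bar> \<le> 1 / (of_int q)\<^sup>2"
proof -
  have "infinite (approx_set \<alpha>)" using rational_iff_finite_approx_set assms by blast
  then obtain h k where "(h, k) \<in> approx_set \<alpha>" "k > N" using infinite_approx_set by blast
  then show ?thesis by (intro exI[of _ h] exI[of _ k]) (auto simp: approx_set_def)
qed

section \<open>A local lower bound for the binomial distribution\<close>

text \<open>The ratio of neighbouring binomial probabilities, kept free of division.\<close>

lemma Bernstein_Suc:
  assumes "k < s"
  shows "Bernstein s (Suc k) x * (real (Suc k) * (1 - x)) = Bernstein s k x * (real (s - k) * x)"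
proof -
  have "Suc k * (s choose Suc k) = (s - k) * (s choose k)"
    using binomial_absorb_comp[of s k] Suc_times_binomial_eq[of "s - 1" k] assms
    by (cases s) auto
  then have "real (Suc k) * real (s choose Suc k) = real (s - k) * real (s choose k)"
    by (metis of_nat_mult)
  moreover have "(1 - x) ^ (s - k) = (1 - x) ^ (s - Suc k) * (1 - x)"
    using assms by (metis Suc_diff_Suc power_Suc2)
  ultimately have "real (Suc k) * real (s choose Suc k) * (x ^ k * x * ((1 - x) ^ (s - Suc k) * (1 - x))) =
      real (s - k) * real (s choose k) * (x ^ k * x * (1 - x) ^ (s - k))"
    by metis
  then show ?thesis unfolding Bernstein_def by (simp only: power_Suc mult_ac)
qed

lemma Bernstein_variance: "(\<Sum>k\<le>s. (real k - s * x)\<^sup>2 * Bernstein s k x) = s * x * (1 - x)"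
proof -
  have "(real k - s * x)\<^sup>2 * Bernstein s k x = real k * (real k - 1) * Bernstein s k x
      + (1 - 2 * (s * x)) * (real k * Bernstein s k x) + (s * x)\<^sup>2 * Bernstein s k x" for k
    by (simp add: algebra_simps power2_eq_square)
  then have "(\<Sum>k\<le>s. (real k - s * x)\<^sup>2 * Bernstein s k x) =
      real s * (real s - 1) * x\<^sup>2 + (1 - 2 * (s * x)) * (s * x) + (s * x)\<^sup>2"
    by (simp add: sum.distrib flip: sum_distrib_left)
  then show ?thesis by (simp add: algebra_simps power2_eq_square)
qed

text \<open>
  By Chebyshev some value near the mean has probability of order \<open>1 / sqrt s\<close>; the ratio of
  neighbouring values is \<open>1 + O(1 / sqrt s)\<close>, so all values near the mean do.
\<close>

lemma Bernstein_local_lower_bound: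
  fixes x :: real
  assumes x: "0 < x" "x < 1"
  shows "\<exists>c>0. \<exists>s0. \<forall>s\<ge>s0. \<forall>k. \<bar>real k - s * x\<bar> \<le> 2 * sqrt s \<longrightarrow> c / sqrt s \<le> Bernstein s k x"
proof -
  define v where "v = x * (1 - x)"
  have v: "v > 0" using x by (simp add: v_def)
  \<comment> \<open>With \<open>sqrt s \<ge> R\<close>, the window \<open>I\<close> below keeps a
    distance of order \<open>s\<close> from \<open>0\<close> and \<open>s\<close>, and
    \<open>\<theta>\<close> is at most \<open>1 / 2\<close>.\<close>
  define R where "R = Max {1, 4 / x, 4 / (1 - x), 12 / v}"
  have "exp (- 48 / v) / 8 / sqrt s \<le> Bernstein s k x"
    if s: "s \<ge> nat \<lceil>R\<^sup>2\<rceil>" and k: "\<bar>real k - s * x\<bar> \<le> 2 * sqrt s" for s k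
  proof -
    define r where "r = sqrt s"
    define I where "I = {k. \<bar>real k - s * x\<bar> \<le> 2 * r}"
    have "R\<^sup>2 \<le> s" using s by linarith
    then have "R \<le> r" unfolding r_def by (rule real_le_rsqrt)
    then have r: "1 \<le> r" "4 / x \<le> r" "4 / (1 - x) \<le> r" "12 / v \<le> r" by (auto simp: R_def)
    have s_eq: "real s = r * r" by (simp add: r_def)
    \<comment> \<open>Inside \<open>I\<close> the two sides \<open>A\<close>, \<open>B\<close> of
      the ratio are at least \<open>s * v / 2\<close> and differ by at most \<open>3 * r\<close>;
      \<open>\<theta>\<close> is the quotient of these bounds.\<close>
    define \<theta> where "\<theta> = 6 / (v * r)"
    have \<theta>: "0 \<le> \<theta>" "\<theta> \<le> 1 / 2" using r(1,4) v by (auto simp: \<theta>_def field_simps)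
    have rx: "4 * r \<le> s * x" "4 * r \<le> s * (1 - x)"
    proof -
      have "4 \<le> r * x" "4 \<le> r * (1 - x)"
        using r(2,3) x by (simp_all add: pos_divide_le_eq)
      then have "r * 4 \<le> r * (r * x)" "r * 4 \<le> r * (r * (1 - x))"
        using r(1) by (intro mult_left_mono; simp)+
      then show "4 * r \<le> s * x" "4 * r \<le> s * (1 - x)" by (simp_all add: s_eq mult_ac)
    qed
    have I_le: "k < s" if "k \<in> I" for k
    proof -
      have "real k \<le> s * x + 2 * r" using that by (simp add: I_def abs_le_iff)
      also have "\<dots> < s * x + s * (1 - x)" using rx(2) r(1) by linarith
      finally show ?thesis by (simp add: algebra_simps)
    qed
    have B_pos: "0 \<le> Bernstein s k x" for k using x by (simp add: Bernstein_nonneg)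
    have step: "(1 - \<theta>) * Bernstein s k x \<le> Bernstein s (Suc k) x"
      "(1 - \<theta>) * Bernstein s (Suc k) x \<le> Bernstein s k x"
      if kI: "k \<in> I" "Suc k \<in> I" for k
    proof -
      define A where "A = real (Suc k) * (1 - x)"
      define B where "B = (real s - real k) * x"
      have AB: "Bernstein s (Suc k) x * A = Bernstein s k x * B"
        using Bernstein_Suc[OF I_le[OF kI(1)], of x] I_le[OF kI(1)] by (simp add: A_def B_def of_nat_diff)
      have diff: "A - B = real k - s * x + (1 - x)" by (simp add: A_def B_def algebra_simps)
      have kb: "\<bar>real k - s * x\<bar> \<le> 2 * r" using kI(1) by (simp add: I_def)
      have "s * x / 2 \<le> real (Suc k)" "s * (1 - x) / 2 \<le> real s - real k"
        using kb rx unfolding right_diff_distrib abs_le_iff by simp_all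
      then have "s * x / 2 * (1 - x) \<le> A" "s * (1 - x) / 2 * x \<le> B"
        unfolding A_def B_def using x by (intro mult_right_mono; simp)+
      then have AB_ge: "s * v / 2 \<le> A" "s * v / 2 \<le> B" by (simp_all add: v_def mult_ac)
      have sv: "s * v / 2 > 0" using v r(1) by (simp add: s_eq)
      then have pos: "A > 0" "B > 0" using AB_ge by linarith+
      have "\<theta> * (s * v / 2) = 3 * r" using v r(1) by (simp add: \<theta>_def s_eq)
      then have \<theta>_ge: "3 * r \<le> \<theta> * A" "3 * r \<le> \<theta> * B"
        using AB_ge \<theta>(1) by (metis mult_left_mono)+
      have "(1 - \<theta>) * A \<le> B" "(1 - \<theta>) * B \<le> A"
        using \<theta>_ge diff kb r(1) x by (auto simp: algebra_simps abs_le_iff)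
      then have *: "Bernstein s k x * ((1 - \<theta>) * A) \<le> Bernstein s k x * B"
        "Bernstein s (Suc k) x * ((1 - \<theta>) * B) \<le> Bernstein s (Suc k) x * A"
        using B_pos by (simp_all add: mult_left_mono)
      show "(1 - \<theta>) * Bernstein s k x \<le> Bernstein s (Suc k) x"
      proof -
        have "A * ((1 - \<theta>) * Bernstein s k x) \<le> A * Bernstein s (Suc k) x"
          using *(1) AB by (simp add: mult_ac)
        then show ?thesis using pos(1) by (simp only: mult_le_cancel_left_pos)
      qed
      show "(1 - \<theta>) * Bernstein s (Suc k) x \<le> Bernstein s k x"
      proof -
        have "B * ((1 - \<theta>) * Bernstein s (Suc k) x) \<le> B * Bernstein s k x"
          using *(2) AB by (simp add: mult_ac)
        then show ?thesis using pos(2) by (simp only: mult_le_cancel_left_pos)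
      qed
    qed
    have I_convex: "j \<in> I" if "a \<in> I" "b \<in> I" "a \<le> j" "j \<le> b" for a b j
    proof -
      have "real a \<le> real j" "real j \<le> real b" using that by simp_all
      then show ?thesis using that(1,2) by (simp add: I_def abs_le_iff)
    qed
    have chain: "(1 - \<theta>) ^ j * Bernstein s a x \<le> Bernstein s (a + j) x \<and>
      (1 - \<theta>) ^ j * Bernstein s (a + j) x \<le> Bernstein s a x" if "a \<in> I" "a + j \<in> I" for a j
      using that
    proof (induction j)
      case (Suc j)
      have aj: "a + j \<in> I" using I_convex[OF Suc.prems] by simp
      note IH = Suc.IH[OF Suc.prems(1) aj]
      note st = step[OF aj] 
      have "(1 - \<theta>) ^ Suc j * Bernstein s a x \<le> (1 - \<theta>) * Bernstein s (a + j) x"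
        using IH \<theta> mult_left_mono[of "(1 - \<theta>) ^ j * Bernstein s a x" "Bernstein s (a + j) x" "1 - \<theta>"]
        by (simp add: mult.assoc)
      also have "\<dots> \<le> Bernstein s (a + Suc j) x" using st(1) Suc.prems by simp
      finally have 1: "(1 - \<theta>) ^ Suc j * Bernstein s a x \<le> Bernstein s (a + Suc j) x" .
      have "(1 - \<theta>) ^ Suc j * Bernstein s (a + Suc j) x =
          (1 - \<theta>) ^ j * ((1 - \<theta>) * Bernstein s (a + Suc j) x)" by (simp add: mult_ac)
      also have "\<dots> \<le> (1 - \<theta>) ^ j * Bernstein s (a + j) x"
        using st(2) Suc.prems \<theta> by (intro mult_left_mono) auto
      also have "\<dots> \<le> Bernstein s a x" using IH by blast
      finally show ?case using 1 by blast
    qed simp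
    \<comment> \<open>Points of \<open>I\<close> are at most \<open>4 * r\<close> steps apart, each
      step costs a factor \<open>1 - \<theta> \<ge> exp (- 2 * \<theta>)\<close>, and
      \<open>2 * \<theta> * 4 * r = 48 / v\<close>.\<close>
    have comparable: "exp (- 48 / v) * Bernstein s a x \<le> Bernstein s b x"
      if ab: "a \<in> I" "b \<in> I" for a b
    proof -
      define j where "j = (if a \<le> b then b - a else a - b)"
      have "real j \<le> 4 * r" using ab by (auto simp: j_def I_def of_nat_diff abs_le_iff)
      then have "\<theta> * real j \<le> \<theta> * (4 * r)" using \<theta>(1) by (intro mult_left_mono)
      also have "\<dots> = 24 / v" using r(1) by (simp add: \<theta>_def)
      finally have "- 48 / v \<le> real j * (- 2 * \<theta>)" by (simp add: field_simps)
      then have "exp (- 48 / v) \<le> exp (- 2 * \<theta>) ^ j" by (simp flip: exp_of_nat_mult)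
      also have "\<dots> \<le> (1 - \<theta>) ^ j"
      proof (rule power_mono)
        have "\<theta> * \<theta> \<le> \<theta> * (1 / 2)" using \<theta> by (intro mult_left_mono)
        then have "- 2 * \<theta> \<le> - \<theta> - 2 * \<theta>\<^sup>2" by (simp add: power2_eq_square)
        also have "\<dots> \<le> ln (1 - \<theta>)" by (rule ln_one_minus_pos_lower_bound[OF \<theta>])
        finally show "exp (- 2 * \<theta>) \<le> 1 - \<theta>" using \<theta> by (simp add: ln_ge_iff)
      qed simp
      finally have "exp (- 48 / v) * Bernstein s a x \<le> (1 - \<theta>) ^ j * Bernstein s a x"
        using B_pos by (rule mult_right_mono)
      also have "\<dots> \<le> Bernstein s b x"
        using chain[of a "b - a"] chain[of b "a - b"] ab by (auto simp: j_def)
      finally show ?thesis .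
    qed
    have I_sub: "I \<subseteq> {..s}" using I_le by (auto intro: less_imp_le)
    then have finI: "finite I" by (rule finite_subset) simp
    \<comment> \<open>Chebyshev: outside \<open>I\<close> the squared deviation exceeds
      \<open>4 * s\<close>, while the variance is at most \<open>s\<close>.\<close>
    have outside: "(\<Sum>k\<in>{..s} - I. Bernstein s k x) \<le> 1 / 4"
    proof -
      have "4 * real s * (\<Sum>k\<in>{..s} - I. Bernstein s k x) \<le> (\<Sum>k\<in>{..s} - I. (real k - s * x)\<^sup>2 * Bernstein s k x)"
        unfolding sum_distrib_left
      proof (intro sum_mono mult_right_mono B_pos)
        fix k assume "k \<in> {..s} - I"
        then have "2 * r \<le> \<bar>real k - s * x\<bar>" by (simp add: I_def)
        then have "(2 * r)\<^sup>2 \<le> \<bar>real k - s * x\<bar>\<^sup>2" using r(1) by (intro power_mono) auto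
        then show "4 * real s \<le> (real k - s * x)\<^sup>2" by (simp add: s_eq power2_eq_square)
      qed
      also have "\<dots> \<le> (\<Sum>k\<le>s. (real k - s * x)\<^sup>2 * Bernstein s k x)"
        using B_pos by (intro sum_mono2) auto
      also have "\<dots> = s * v" unfolding Bernstein_variance by (simp add: v_def)
      also have "\<dots> \<le> real s * 1" using x unfolding v_def by (intro mult_left_mono mult_le_one) auto
      finally show ?thesis using r(1) by (simp add: s_eq)
    qed
    have "1 = (\<Sum>k\<in>{..s} - I. Bernstein s k x) + (\<Sum>k\<in>I. Bernstein s k x)"
      using sum.subset_diff[OF I_sub, of "\<lambda>k. Bernstein s k x"] by simp
    then have inside: "3 / 4 \<le> (\<Sum>k\<in>I. Bernstein s k x)" using outside by linarith
    have "real (card I) \<le> 5 * r"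
    proof -
      have "I \<subseteq> {nat \<lceil>s * x - 2 * r\<rceil>..nat \<lfloor>s * x + 2 * r\<rfloor>}"
        by (auto simp: I_def abs_le_iff le_nat_floor nat_le_iff ceiling_le_iff)
      then have "card I \<le> nat \<lfloor>s * x + 2 * r\<rfloor> + 1 - nat \<lceil>s * x - 2 * r\<rceil>"
        by (metis card_mono finite_atLeastAtMost card_atLeastAtMost Suc_eq_plus1)
      then have "real (card I) \<le> (s * x + 2 * r) + 1 - (s * x - 2 * r)"
        using rx(1) r(1) by linarith
      then show ?thesis using r(1) by simp
    qed
    have kI: "k \<in> I" using k by (simp add: I_def r_def)
    \<comment> \<open>Mass \<open>3 / 4\<close> is spread over at most \<open>5 * r\<close> points,
      all comparable to \<open>k\<close>; the resulting factor \<open>20 / 3\<close> is relaxed to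
      \<open>8\<close>.\<close>
    have "exp (- 48 / v) * (3 / 4) \<le> exp (- 48 / v) * (\<Sum>j\<in>I. Bernstein s j x)"
      using inside by (intro mult_left_mono) auto
    also have "\<dots> \<le> (\<Sum>j\<in>I. Bernstein s k x)"
      unfolding sum_distrib_left by (intro sum_mono comparable kI)
    also have "\<dots> = real (card I) * Bernstein s k x" by simp
    also have "\<dots> \<le> 5 * r * Bernstein s k x"
      using \<open>real (card I) \<le> 5 * r\<close> B_pos by (rule mult_right_mono)
    finally have "exp (- 48 / v) * (3 / 4) \<le> 5 * (r * Bernstein s k x)" by simp
    moreover have "0 \<le> r * Bernstein s k x" using r(1) B_pos by simp
    ultimately have "exp (- 48 / v) \<le> 8 * (r * Bernstein s k x)" by linarith
    then show ?thesis unfolding r_def[symmetric] using r(1) by (simp add: field_simps)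
  qed
  then show ?thesis by (intro exI[of _ "exp (- 48 / v) / 8"] conjI exI[of _ "nat \<lceil>R\<^sup>2\<rceil>"]) auto
qed

context bernoulli_source
begin

lemma stop_mean_sum:
  "finite I \<Longrightarrow> stop_mean S (\<lambda>v. \<Sum>k\<in>I. c k * G k v) u T = (\<Sum>k\<in>I. c k * stop_mean S (G k) u T)"
  by (induction I rule: finite_induct) (simp_all add: stop_mean_const stop_mean_add stop_mean_cmult)

text \<open>The defining recursion peels off the first symbol; this form peels off the last.\<close>

lemma mean_Suc_inner: "mean f u (Suc T) = mean (\<lambda>v. \<Sum>i<m. p i * f (v @ [i])) u T"
proof (induction T arbitrary: u)
  case (Suc T)
  have "mean f u (Suc (Suc T)) = (\<Sum>i<m. p i * mean f (u @ [i]) (Suc T))" by simp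
  also have "\<dots> = (\<Sum>i<m. p i * mean (\<lambda>v. \<Sum>i<m. p i * f (v @ [i])) (u @ [i]) T)"
    by (simp only: Suc.IH)
  finally show ?case by simp
qed simp

end

section \<open>Hitting probabilities\<close>

context bernoulli_coding
begin

text \<open>Deliberately not normalized: the weights of \<open>s\<close> steps sum to
  \<open>(p i + p j) ^ s\<close>, the probability that \<open>s\<close> symbols all come from the
  pair.\<close>

fun pair_mean :: "nat \<Rightarrow> nat \<Rightarrow> (real \<Rightarrow> real) \<Rightarrow> nat \<Rightarrow> real \<Rightarrow> real" where
  "pair_mean i j g 0 x = g x"
| "pair_mean i j g (Suc s) x =
    p i * pair_mean i j g s (x + cost i) + p j * pair_mean i j g s (x + cost j)"

lemma pair_mean_nonneg:
  assumes "i < m" "j < m" "\<And>x. 0 \<le> g x"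
  shows "0 \<le> pair_mean i j g s x"
  using assms by (induction s arbitrary: x) (auto intro!: add_nonneg_nonneg mult_nonneg_nonneg p_nonneg)

text \<open>Only the paths with exactly \<open>k\<close> symbols \<open>i\<close> are kept. They all
  end at the same phase, and Pascal's rule counts them.\<close>

lemma pair_mean_ge_binomial:
  assumes "i < m" "j < m" and g: "\<And>x. 0 \<le> g x" and "k \<le> s"
  shows "real (s choose k) * p i ^ k * p j ^ (s - k) * g (x + k * cost i + real (s - k) * cost j)
    \<le> pair_mean i j g s x"
  using assms(4)
proof (induction s arbitrary: x k)
  case 0
  then show ?case by simp
next
  case (Suc s)
  define G where "G = g (x + k * cost i + real (Suc s - k) * cost j)"
  have G: "0 \<le> G" unfolding G_def by (rule g)
  have first: "real (s choose (k - 1)) * p i ^ k * p j ^ (Suc s - k) * G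
      \<le> p i * pair_mean i j g s (x + cost i)" if k: "k > 0"
  proof -
    obtain l where l: "k = Suc l" using k by (cases k) auto
    have "real (s choose l) * p i ^ l * p j ^ (s - l) *
        g (x + cost i + l * cost i + real (s - l) * cost j) \<le> pair_mean i j g s (x + cost i)"
      using Suc.prems l by (intro Suc.IH) simp
    moreover have "x + cost i + l * cost i + real (s - l) * cost j = x + k * cost i + real (Suc s - k) * cost j"
      using l by (simp add: algebra_simps)
    ultimately have "p i * (real (s choose l) * p i ^ l * p j ^ (s - l) * G) \<le> p i * pair_mean i j g s (x + cost i)"
      unfolding G_def using assms(1) by (intro mult_left_mono p_nonneg) auto
    then show ?thesis using l by (simp add: mult_ac)
  qed
  have second: "real (s choose k) * p i ^ k * p j ^ (Suc s - k) * G
      \<le> p j * pair_mean i j g s (x + cost j)"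
  proof (cases "k \<le> s")
    case True
    have "real (s choose k) * p i ^ k * p j ^ (s - k) *
        g (x + cost j + k * cost i + real (s - k) * cost j) \<le> pair_mean i j g s (x + cost j)"
      using True by (rule Suc.IH)
    moreover have "x + cost j + k * cost i + real (s - k) * cost j = x + k * cost i + real (Suc s - k) * cost j"
      using True by (simp add: of_nat_diff algebra_simps)
    ultimately have "p j * (real (s choose k) * p i ^ k * p j ^ (s - k) * G) \<le> p j * pair_mean i j g s (x + cost j)"
      unfolding G_def using assms(2) by (intro mult_left_mono p_nonneg) auto
    then show ?thesis using True by (simp add: Suc_diff_le mult_ac)
  next
    case False
    then show ?thesis
      using assms p_nonneg by (auto intro!: mult_nonneg_nonneg pair_mean_nonneg simp: binomial_eq_0)
  qed
  show ?case
  proof (cases k)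
    case 0
    then show ?thesis
      using second assms p_nonneg unfolding G_def
      by (auto intro!: add_increasing mult_nonneg_nonneg pair_mean_nonneg)
  next
    case (Suc l)
    then show ?thesis using first second unfolding G_def[symmetric] by (simp add: algebra_simps)
  qed
qed

lemma pair_mean_ge_Bernstein:
  assumes "i < m" "j < m" "\<And>x. 0 \<le> g x" "k \<le> s"
  shows "(p i + p j) ^ s * Bernstein s k (p i / (p i + p j)) * g (x + s * cost j + k * (cost i - cost j))
    \<le> pair_mean i j g s x"
proof -
  define r where "r = p i + p j"
  have r: "r > 0" using p_pos assms by (simp add: r_def add_pos_pos)
  have "r ^ s = r ^ k * r ^ (s - k)" using assms(4) by (simp flip: power_add)
  moreover have "1 - p i / r = p j / r" using r by (simp add: r_def field_simps)
  ultimately have eq: "r ^ s * Bernstein s k (p i / r) = real (s choose k) * p i ^ k * p j ^ (s - k)"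
    using r by (simp add: Bernstein_def power_divide)
  have eq': "x + s * cost j + k * (cost i - cost j) = x + k * cost i + real (s - k) * cost j"
    using assms(4) by (simp add: of_nat_diff algebra_simps)
  show ?thesis unfolding r_def[symmetric] eq eq' by (rule pair_mean_ge_binomial[OF assms])
qed

text \<open>
  Reading \<open>L\<close> symbols, at least \<open>s0\<close> of them are \<open>i\<close> or \<open>j\<close> except with probability at most
  \<open>2 ^ s0 * (1 - r / 2) ^ L\<close>, which is Markov's inequality for \<open>2 powr (- N)\<close> where
  \<open>N\<close> counts these symbols.
\<close>

lemma mean_pair_mean_ge:
  fixes i j s0 M :: nat and b :: real
  defines "r \<equiv> p i + p j"
  assumes ij: "i < m" "j < m" "i \<noteq> j" and g: "\<And>x. 0 \<le> g x" and b: "0 \<le> b"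
    and bound: "\<And>s x. s0 \<le> s \<Longrightarrow> s \<le> M \<Longrightarrow> r ^ s * b \<le> pair_mean i j g s x"
  shows "s + L \<le> M \<Longrightarrow> r ^ s * b * (1 - 2 ^ s0 / 2 ^ s * (1 - r / 2) ^ L)
    \<le> mean (\<lambda>v. pair_mean i j g s (phase v + y)) u L"
proof (induction L arbitrary: s y)
  case 0
  have r: "0 < r" using p_pos ij by (simp add: r_def add_pos_pos)
  show ?case
  proof (cases "s0 \<le> s")
    case True
    have "r ^ s * b * (1 - 2 ^ s0 / 2 ^ s) \<le> r ^ s * b"
      using r b by (intro mult_left_le) auto
    also have "\<dots> \<le> pair_mean i j g s (phase u + y)" using True 0 by (intro bound) auto
    finally show ?thesis by simp
  next
    \<comment> \<open>Too few pair symbols have been collected; the claimed lower bound is then not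
      positive.\<close>
    case False
    then have "(2::real) ^ s \<le> 2 ^ s0" by simp
    then have "1 - 2 ^ s0 / 2 ^ s \<le> (0::real)" by simp
    then have "r ^ s * b * (1 - 2 ^ s0 / 2 ^ s) \<le> 0"
      using r b by (intro mult_nonneg_nonpos) auto
    also have "\<dots> \<le> pair_mean i j g s (phase u + y)" using ij g by (rule_tac pair_mean_nonneg)
    finally show ?thesis by simp
  qed
next
  case (Suc L)
  define X where "X = 2 ^ s0 / 2 ^ s * (1 - r / 2) ^ L"
  define R where "R = {..<m} - {i, j}"
  have split: "(\<Sum>k<m. f k) = f i + f j + (\<Sum>k\<in>R. f k)" for f :: "nat \<Rightarrow> real"
  proof -
    have "(\<Sum>k<m. f k) = (\<Sum>k\<in>R. f k) + (\<Sum>k\<in>{i, j}. f k)"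
      unfolding R_def using ij by (intro sum.subset_diff) auto
    then show ?thesis using ij(3) by simp
  qed
  have sum_R: "(\<Sum>k\<in>R. p k) = 1 - r" using split[of p] sum_p by (simp add: r_def)
  \<comment> \<open>The last symbol is peeled off. If it belongs to the pair (weight
    \<open>r\<close>), it becomes one more step of \<open>pair_mean\<close>, which halves
    \<open>X\<close>; otherwise (weight \<open>1 - r\<close>) it only shifts the offset
    \<open>y\<close>.\<close>
  have "r ^ s * b * (1 - 2 ^ s0 / 2 ^ s * (1 - r / 2) ^ Suc L) =
      r ^ Suc s * b * (1 - X / 2) + (1 - r) * (r ^ s * b * (1 - X))"
  proof -
    have X: "2 ^ s0 / 2 ^ s * (1 - r / 2) ^ Suc L = X * (1 - r / 2)" by (simp add: X_def)
    show ?thesis unfolding X unfolding power_Suc by (simp add: algebra_simps)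
  qed
  also have "r ^ Suc s * b * (1 - X / 2) \<le> mean (\<lambda>v. pair_mean i j g (Suc s) (phase v + y)) u L"
  proof -
    have X: "2 ^ s0 / 2 ^ Suc s * (1 - r / 2) ^ L = X / 2" by (simp add: X_def)
    have "Suc s + L \<le> M" using Suc.prems by simp
    from Suc.IH[OF this, of y] show ?thesis unfolding X .
  qed
  also have "(1 - r) * (r ^ s * b * (1 - X)) \<le>
      (\<Sum>k\<in>R. p k * mean (\<lambda>v. pair_mean i j g s (phase v + (cost k + y))) u L)"
    unfolding sum_R[symmetric] sum_distrib_right
  proof (intro sum_mono mult_left_mono)
    fix k assume "k \<in> R"
    then show "0 \<le> p k" using p_nonneg by (simp add: R_def)
    show "r ^ s * b * (1 - X) \<le> mean (\<lambda>v. pair_mean i j g s (phase v + (cost k + y))) u L"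
      unfolding X_def using Suc.prems by (intro Suc.IH) simp
  qed
  also have "mean (\<lambda>v. pair_mean i j g (Suc s) (phase v + y)) u L +
      (\<Sum>k\<in>R. p k * mean (\<lambda>v. pair_mean i j g s (phase v + (cost k + y))) u L) =
      mean (\<lambda>v. pair_mean i j g (Suc s) (phase v + y) +
        (\<Sum>k\<in>R. p k * pair_mean i j g s (phase v + (cost k + y)))) u L"
    by (simp only: stop_mean_add) (simp add: stop_mean_sum R_def)
  also have "\<dots> = mean (\<lambda>v. \<Sum>k<m. p k * pair_mean i j g s (phase (v @ [k]) + y)) u L"
    unfolding split by (simp add: add_ac)
  also have "\<dots> = mean (\<lambda>v. pair_mean i j g s (phase v + y)) u (Suc L)"
    unfolding mean_Suc_inner ..
  finally show ?case by simp
qed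

text \<open>The hypothesis of \<open>code_of_hitting_bound\<close> at scale \<open>q\<close>:
  tolerance \<open>3 / q\<close>, time of order \<open>q ^ 2\<close>, probability of order
  \<open>1 / q\<close>.\<close>

definition hitting :: "nat \<Rightarrow> real \<Rightarrow> nat \<Rightarrow> bool" where
  "hitting C b q \<longleftrightarrow> (\<forall>u\<in>lists {..<m}. \<forall>up. \<exists>t. 1 \<le> t \<and> t \<le> C * q\<^sup>2 \<and>
     b / q \<le> mean (\<lambda>v. if near_int (3 / q) up (phase v) then 1 else 0) u t)"

text \<open>Replacing a \<open>j\<close> by an \<open>i\<close> rotates the phase by
  \<open>\<alpha> = cost i - cost j\<close>. Some count of \<open>i\<close> among \<open>q\<close>
  consecutive ones near its mean gives a hit; after order \<open>q ^ 2\<close> symbols of the pair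
  its binomial probability is of order \<open>1 / q\<close>.\<close>

lemma hitting_irrational:
  assumes ij: "i < m" "j < m" and irrat: "cost i - cost j \<notin> \<rat>"
  shows "\<exists>C b. 0 < b \<and> (\<forall>N. \<exists>q>N. hitting C b q)"
proof -
  define r where "r = p i + p j"
  define x0 where "x0 = p i / r"
  have neq: "i \<noteq> j" using irrat by auto
  have r: "0 < r" using p_pos ij by (simp add: r_def add_pos_pos)
  have "r = (\<Sum>k\<in>{i, j}. p k)" using neq by (simp add: r_def)
  also have "\<dots> \<le> (\<Sum>k<m. p k)" using ij p_nonneg by (intro sum_mono2) auto
  finally have r1: "r \<le> 1" using sum_p by simp
  have x0: "0 < x0" "x0 < 1" using p_pos[OF ij(1)] p_pos[OF ij(2)] r by (auto simp: x0_def r_def)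
  obtain c s1 where c: "c > 0" and local:
    "\<And>s k. s \<ge> s1 \<Longrightarrow> \<bar>real k - s * x0\<bar> \<le> 2 * sqrt s \<Longrightarrow> c / sqrt s \<le> Bernstein s k x0"
    using Bernstein_local_lower_bound[OF x0] by blast
  \<comment> \<open>Reading \<open>C * s0\<close> symbols then makes the exceptional term
    \<open>2 ^ s0 * (1 - r / 2) ^ (C * s0)\<close> at most \<open>1 / 2\<close>.\<close>
  obtain C0 where C0: "(1 - r / 2) ^ C0 < 1 / 4"
    using real_arch_pow_inv[of "1 / 4" "1 - r / 2"] r by auto
  define C where "C = Suc C0"
  have C: "C \<ge> 1" "(1 - r / 2) ^ C \<le> 1 / 4"
  proof -
    have "(1 - r / 2) ^ C \<le> (1 - r / 2) ^ C0" unfolding C_def using r r1 by (intro power_decreasing) auto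
    then show "(1 - r / 2) ^ C \<le> 1 / 4" using C0 by simp
  qed (simp add: C_def)
  define b where "b = c / (4 * sqrt C)"
  have b: "b > 0" using c C(1) by (simp add: b_def)
  have "\<exists>q>N. hitting (4 * C) b q" for N
  proof -
    obtain h q' :: int where q': "q' > int (N + s1)" "q' > 0" "coprime h q'"
      "\<bar>(cost i - cost j) - h / q'\<bar> \<le> 1 / q'\<^sup>2"
      using irrational_approx[OF irrat] by (metis of_int_power)
    define q where "q = nat q'"
    have q: "q > N" "q \<ge> s1" "q \<ge> 1" "q' = int q" using q' by (auto simp: q_def)
    \<comment> \<open>This makes \<open>sqrt s \<ge> 2 * q\<close>, so \<open>q\<close> consecutive
      counts starting at the mean stay in the range of the local bound.\<close>
    define s0 where "s0 = 4 * q\<^sup>2"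
    have s0: "s0 \<ge> s1" "s0 \<ge> 1"
    proof -
      have "q \<le> q\<^sup>2" using q(3) by (simp add: power2_eq_square)
      then show "s0 \<ge> s1" "s0 \<ge> 1" using q by (auto simp: s0_def)
    qed
    have "\<exists>t. 1 \<le> t \<and> t \<le> 4 * C * q\<^sup>2 \<and>
       b / q \<le> mean (\<lambda>v. if near_int (3 / q) up (phase v) then 1 else 0) u t" for u up
    proof -
      define g :: "real \<Rightarrow> real" where "g x = (if near_int (3 / q) up x then 1 else 0)" for x
      define B where "B = c / (sqrt C * (2 * real q))"
      have B: "B \<ge> 0" using c C(1) by (simp add: B_def)
      have g_nonneg: "0 \<le> g x" for x by (simp add: g_def)
      have bound: "r ^ s * B \<le> pair_mean i j g s x" if s: "s0 \<le> s" "s \<le> C * s0" for s x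
      proof -
        obtain k where k: "\<lceil>s * x0\<rceil> \<le> k" "k < \<lceil>s * x0\<rceil> + q'"
          "near_int (3 / q') up (x + s * cost j + k * (cost i - cost j))"
          using near_int_rotation[OF q'(2-4)] by blast
        have "0 \<le> s * x0" using x0 by simp
        then have k0: "0 \<le> k" using k(1) by linarith
        define k' where "k' = nat k"
        have k': "real k' = k" using k0 by (simp add: k'_def)
        have sqrt_s: "2 * real q \<le> sqrt (real s)"
        proof (rule real_le_rsqrt)
          have "real s0 \<le> real s" using s(1) by simp
          then show "(2 * real q)\<^sup>2 \<le> real s" by (simp add: s0_def power_mult_distrib)
        qed
        have near: "\<bar>real k' - s * x0\<bar> \<le> 2 * sqrt s"
          using k(1,2) q sqrt_s unfolding k' by linarith
        then have Bern: "c / sqrt s \<le> Bernstein s k' x0" using s(1) s0(1) by (intro local) auto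
        moreover have "c / sqrt s > 0" using c s(1) s0(2) by simp
        ultimately have "Bernstein s k' x0 > 0" by linarith
        \<comment> \<open>The local bound itself excludes \<open>k' > s\<close>, where the binomial
          probability vanishes.\<close>
        then have "k' \<le> s" by (rule_tac ccontr) (simp add: Bernstein_def binomial_eq_0)
        then have "r ^ s * Bernstein s k' x0 * g (x + s * cost j + k' * (cost i - cost j)) \<le> pair_mean i j g s x"
          unfolding r_def x0_def using ij g_nonneg by (intro pair_mean_ge_Bernstein)
        moreover have "g (x + s * cost j + k' * (cost i - cost j)) = 1"
          using k(3) k' q(4) by (simp add: g_def)
        moreover have "B \<le> c / sqrt s"
        proof -
          have "real s \<le> real (C * s0)" using s(2) by (simp only: of_nat_le_iff)
          then have "real s \<le> real C * (2 * real q)\<^sup>2" by (simp add: s0_def power_mult_distrib)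
          then have "sqrt s \<le> sqrt (real C * (2 * real q)\<^sup>2)" by (rule real_sqrt_le_mono)
          also have "\<dots> = sqrt C * (2 * real q)" by (simp add: real_sqrt_mult)
          finally show ?thesis unfolding B_def using c s(1) s0(2) C(1) q(3) by (intro divide_left_mono) auto
        qed
        then have "r ^ s * B \<le> r ^ s * Bernstein s k' x0" using Bern r by (intro mult_left_mono) auto
        ultimately show ?thesis by simp
      qed
      have "r ^ 0 * B * (1 - 2 ^ s0 / 2 ^ 0 * (1 - r / 2) ^ (C * s0))
          \<le> mean (\<lambda>v. pair_mean i j g 0 (phase v + 0)) u (C * s0)"
        unfolding r_def
        by (rule mean_pair_mean_ge[where M = "C * s0"])
          (use ij neq g_nonneg B bound in \<open>auto simp: r_def\<close>)
      moreover have "b / q \<le> B * (1 - 2 ^ s0 * (1 - r / 2) ^ (C * s0))"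
      proof -
        have "2 ^ s0 * (1 - r / 2) ^ (C * s0) = (2 * (1 - r / 2) ^ C) ^ s0"
          by (simp add: power_mult power_mult_distrib)
        also have "\<dots> \<le> (1 / 2) ^ s0" using C(2) r r1 by (intro power_mono) auto
        also have "\<dots> \<le> (1 / 2) ^ 1" using s0(2) by (intro power_decreasing) auto
        finally have "B * (1 / 2) \<le> B * (1 - 2 ^ s0 * (1 - r / 2) ^ (C * s0))"
          using B by (intro mult_left_mono) auto
        moreover have "B * (1 / 2) = b / q" by (simp add: B_def b_def)
        ultimately show ?thesis by simp
      qed
      ultimately have "b / q \<le> mean (\<lambda>v. g (phase v)) u (C * s0)" by simp
      then show ?thesis
        using C(1) s0(2) unfolding g_def by (intro exI[of _ "C * s0"]) (auto simp: s0_def)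
    qed
    then show ?thesis unfolding hitting_def using q(1) by blast
  qed
  then show ?thesis using b by blast
qed

end

section \<open>Rational cost differences: reduction to a rotation\<close>

lemma common_denominator:
  fixes f :: "'a \<Rightarrow> real"
  assumes "finite I" and "\<And>i. i \<in> I \<Longrightarrow> f i \<in> \<rat>"
  shows "\<exists>D::nat. D > 0 \<and> (\<forall>i\<in>I. real D * f i \<in> \<int>)"
  using assms
proof (induction I rule: finite_induct)
  case empty
  then show ?case by (intro exI[of _ 1]) simp
next
  case (insert a I)
  obtain D :: nat where D: "D > 0" "\<forall>i\<in>I. real D * f i \<in> \<int>" using insert by auto
  obtain k l :: int where kl: "f a = k / l" "l > 0"
    using insert.prems[of a] by (auto elim: Rats_cases')
  have "real (D * nat l) * f a = real_of_int (D * k)" using kl by simp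
  then have "real (D * nat l) * f a \<in> \<int>" by (metis Ints_of_int)
  moreover have "real (D * nat l) * f i \<in> \<int>" if "i \<in> I" for i
  proof -
    have "real (D * nat l) * f i = real (nat l) * (real D * f i)" by simp
    then show ?thesis using D(2) that by (metis Ints_mult Ints_of_nat)
  qed
  ultimately show ?case using D(1) kl(2) by (intro exI[of _ "D * nat l"]) auto
qed

text \<open>The amount added lies between \<open>1\<close> and \<open>D\<close>; it is
  \<open>D\<close> rather than \<open>0\<close> if \<open>D\<close> already divides
  \<open>c\<close>.\<close>

lemma dvd_add_diff_mod:
  fixes D c :: nat
  assumes "D > 0"
  shows "D dvd c + (D - c mod D)"
proof -
  have "c = D * (c div D) + c mod D" "c mod D < D" using assms by simp_all
  then have "c + (D - c mod D) = D * (c div D + 1)" by (metis add.assoc add_mult_distrib2 le_add_diff_inverse less_imp_le mult.right_neutral)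
  then show ?thesis by (metis dvd_triv_left)
qed

text \<open>A rational \<open>\<alpha>\<close> returns exactly to an integer at the multiples of its
  denominator; for an irrational one \<open>near_int_rotation\<close> applies along its
  approximations.\<close>

lemma rotation_hits:
  fixes \<alpha> :: real
  shows "\<exists>C. \<forall>N. \<exists>q>N. \<forall>a up. \<exists>k. a \<le> k \<and> k \<le> a + C * q \<and> near_int (3 / real q) up (real k * \<alpha>)"
proof (cases "\<alpha> \<in> \<rat>")
  case True
  then obtain D :: nat where D: "D > 0" "real D * \<alpha> \<in> \<int>"
    using common_denominator[of "{()}" "\<lambda>_. \<alpha>"] by auto
  have "\<exists>k. a \<le> k \<and> k \<le> a + D * Suc N \<and> near_int (3 / real (Suc N)) up (real k * \<alpha>)" for a up N
  proof -
    define k where "k = a + (D - a mod D)"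
    obtain l where "k = D * l" using dvd_add_diff_mod[OF D(1), of a] by (auto simp: k_def elim: dvdE)
    then have "real k * \<alpha> = real l * (real D * \<alpha>)" by simp
    then have "real k * \<alpha> \<in> \<int>" using D(2) by (metis Ints_mult Ints_of_nat)
    moreover have "k \<le> a + D * Suc N" by (simp add: k_def)
    ultimately show ?thesis by (intro exI[of _ k]) (auto simp: k_def intro!: near_int_of_Ints)
  qed
  then show ?thesis by (metis lessI)
next
  case False
  have "\<exists>q>N. \<forall>a up. \<exists>k. a \<le> k \<and> k \<le> a + 1 * q \<and> near_int (3 / real q) up (real k * \<alpha>)" for N
  proof -
    obtain h q :: int where q: "q > int N" "q > 0" "coprime h q" "\<bar>\<alpha> - h / q\<bar> \<le> 1 / q\<^sup>2"
      using irrational_approx[OF False] by (metis of_int_power)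
    have "\<exists>k. a \<le> k \<and> k \<le> a + 1 * nat q \<and> near_int (3 / real (nat q)) up (real k * \<alpha>)" for a up
    proof -
      obtain k where k: "int a \<le> k" "k < int a + q" "near_int (3 / q) up (0 + k * \<alpha>)"
        using near_int_rotation[OF q(2-4)] by blast
      then show ?thesis using q(2) by (intro exI[of _ "nat k"]) auto
    qed
    then show ?thesis using q(1) by (intro exI[of _ "nat q"]) auto
  qed
  then show ?thesis by blast
qed

text \<open>Bernoulli's inequality for \<open>(1 / \<rho>) ^ N\<close>.\<close>

lemma power_le_inverse_linear:
  fixes \<rho> :: real
  assumes "0 < \<rho>" "\<rho> < 1" "N > 0"
  shows "\<rho> ^ N \<le> \<rho> / (1 - \<rho>) / N"
proof -
  have "N * (1 / \<rho> - 1) \<le> (1 + (1 / \<rho> - 1)) ^ N"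
    using Bernoulli_inequality[of "1 / \<rho> - 1" N] assms by simp
  then have "N * (1 / \<rho> - 1) \<le> 1 / \<rho> ^ N" by (simp add: power_one_over)
  then show ?thesis using assms by (simp add: field_simps)
qed

context bernoulli_coding
begin

lemma phase_eq_count:
  assumes "v \<in> lists {..<m}"
  shows "phase v - length v * cost 0 = (\<Sum>i<m. count_list v i * (cost i - cost 0))"
  using assms
proof (induction v)
  case Nil
  then show ?case by (simp add: phase_def)
next
  case (Cons a v)
  have "(\<Sum>i<m. real (count_list (a # v) i) * (cost i - cost 0)) =
      (\<Sum>i<m. (if i = a then cost i - cost 0 else 0) + count_list v i * (cost i - cost 0))"
    by (intro sum.cong) (auto simp: algebra_simps)
  also have "\<dots> = (cost a - cost 0) + (phase v - length v * cost 0)"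
    using Cons by (simp add: sum.distrib)
  finally show ?case by (simp add: phase_def algebra_simps)
qed

text \<open>Modulo \<open>1\<close> a phase with all counts of nonzero symbols divisible by
  \<open>D\<close> equals the length times \<open>cost 0\<close>. Such counts can be reached by a
  suffix whose length does not depend on \<open>v\<close>.\<close>

lemma padding:
  assumes D: "D > 0" "\<And>i. i < m \<Longrightarrow> real D * (cost i - cost 0) \<in> \<int>" and v: "v \<in> lists {..<m}"
  shows "\<exists>w\<in>lists {..<m}. length w = m * D \<and> phase (v @ w) - length (v @ w) * cost 0 \<in> \<int>"
proof -
  have "\<exists>w\<in>lists {..<m}. length w = j * D \<and> (\<forall>i. 0 < i \<and> i < j \<longrightarrow> D dvd count_list (v @ w) i)"
    if "j \<le> m" for j
    using that
  proof (induction j)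
    case 0
    then show ?case by (intro bexI[of _ "[]"]) auto
  next
    case (Suc j)
    then obtain w where w: "w \<in> lists {..<m}" "length w = j * D"
      "\<And>i. 0 < i \<Longrightarrow> i < j \<Longrightarrow> D dvd count_list (v @ w) i" by auto
    define a where "a = D - count_list (v @ w) j mod D"
    \<comment> \<open>Each symbol gets a block of length \<open>D\<close>: \<open>a\<close> copies
      correct its count, and zeros, which add nothing to \<open>cost i - cost 0\<close>, fill up the
      block.\<close>
    define w' where "w' = w @ replicate a j @ replicate (D - a) 0"
    have count: "count_list (replicate k x) i = (if i = x then k else 0)" for k and x i :: nat
      by (induction k) auto
    have "a \<le> D" by (simp add: a_def)
    then have "length w' = Suc j * D" using w(2) by (simp add: w'_def)
    moreover have "w' \<in> lists {..<m}" using w(1) Suc.prems by (auto simp: w'_def)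
    moreover have "D dvd count_list (v @ w') i" if "0 < i" "i < Suc j" for i
    proof (cases "i = j")
      case True
      then have "count_list (v @ w') i = count_list (v @ w) j + a"
        using that by (simp add: w'_def count)
      then show ?thesis using dvd_add_diff_mod[OF D(1)] unfolding a_def by simp
    next
      case False
      then show ?thesis using w(3)[of i] that by (simp add: w'_def count)
    qed
    ultimately show ?case by blast
  qed
  from this[of m] obtain w where w: "w \<in> lists {..<m}" "length w = m * D"
    "\<And>i. 0 < i \<Longrightarrow> i < m \<Longrightarrow> D dvd count_list (v @ w) i" by auto
  have "real (count_list (v @ w) i) * (cost i - cost 0) \<in> \<int>" if im: "i < m" for i
  proof (cases "i = 0")
    case False
    then obtain l where "count_list (v @ w) i = D * l" using w(3)[of i] im by (auto elim: dvdE)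
    then have "real (count_list (v @ w) i) * (cost i - cost 0) = l * (D * (cost i - cost 0))" by simp
    then show ?thesis using D(2)[OF im] by (metis Ints_mult Ints_of_nat)
  qed simp
  then have "phase (v @ w) - length (v @ w) * cost 0 \<in> \<int>"
    using v w(1) by (subst phase_eq_count) (auto intro!: Ints_sum)
  then show ?thesis using w by blast
qed

text \<open>Choose a final length \<open>k\<close> with \<open>k * cost 0\<close> close to an
  integer and let the last \<open>m * D\<close> symbols be the padding word. That word has
  probability bounded below, so the hit has constant probability.\<close>

lemma hitting_rational:
  assumes rat: "\<And>i. i < m \<Longrightarrow> cost i - cost 0 \<in> \<rat>"
  shows "\<exists>C b. 0 < b \<and> (\<forall>N. \<exists>q>N. hitting C b q)"
proof -
  obtain D :: nat where D: "D > 0" "\<And>i. i < m \<Longrightarrow> real D * (cost i - cost 0) \<in> \<int>"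
    using common_denominator[of "{..<m}" "\<lambda>i. cost i - cost 0"] rat by auto
  obtain C1 where C1: "\<And>N. \<exists>q>N. \<forall>a up. \<exists>k. a \<le> k \<and> k \<le> a + C1 * q \<and>
      near_int (3 / real q) up (real k * cost 0)"
    using rotation_hits[of "cost 0"] by blast
  define \<pi> where "\<pi> = Min (p ` {..<m})"
  have fin: "finite (p ` {..<m})" "p ` {..<m} \<noteq> {}" using m_ge_2 by (auto simp: lessThan_empty_iff)
  have \<pi>: "0 < \<pi>" "\<And>i. i < m \<Longrightarrow> \<pi> \<le> p i" using fin p_pos by (auto simp: \<pi>_def)
  have word_prob_ge: "\<pi> ^ length w \<le> word_prob p w" if "w \<in> lists {..<m}" for w
    using that
  proof (induction w)
    case (Cons i w)
    then have "\<pi> * \<pi> ^ length w \<le> p i * word_prob p w"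
      using \<pi>(1) \<pi>(2)[of i] by (intro mult_mono) auto
    then show ?case by (simp add: word_prob_def)
  qed (simp add: word_prob_def)
  define b where "b = \<pi> ^ (m * D)"
  define C where "C = m * D + C1"
  have b: "0 < b" using \<pi>(1) by (simp add: b_def)
  have "hitting C b q"
    if q: "q > 0" and rot: "\<And>a up. \<exists>k. a \<le> k \<and> k \<le> a + C1 * q \<and> near_int (3 / real q) up (real k * cost 0)" for q
    unfolding hitting_def
  proof (intro ballI allI)
    fix u up assume u: "u \<in> lists {..<m}"
    obtain k where k: "length u + m * D \<le> k" "k \<le> length u + m * D + C1 * q"
      "near_int (3 / real q) up (real k * cost 0)" using rot by blast
    define f where "f v = (if near_int (3 / q) up (phase v) then 1 else 0 :: real)" for v
    define t where "t = k - length u - m * D"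
    have "b \<le> mean (\<lambda>v. mean f v (m * D)) u t"
    proof -
      have "b \<le> mean f (u @ w) (m * D)" if w: "w \<in> stop_tree (\<lambda>_. False) u t" for w
      proof -
        have wl: "w \<in> lists {..<m}" using w by (rule stop_tree_lists)
        have "length w = t" using length_stop_tree[OF w] length_stop_tree_ge[of w _ u t 0] w by simp
        then have len: "length (u @ w) + m * D = k" using k(1) by (simp add: t_def)
        obtain w' where w': "w' \<in> lists {..<m}" "length w' = m * D"
          "phase ((u @ w) @ w') - length ((u @ w) @ w') * cost 0 \<in> \<int>"
          using padding[OF D, of "u @ w"] u wl unfolding append_in_lists_conv by blast
        have "length ((u @ w) @ w') = k" using len w'(2) by simp
        then have "near_int (3 / q) up (phase ((u @ w) @ w'))"
          using near_int_add_int[OF k(3) w'(3)] by simp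
        then have "b \<le> word_prob p w' * f ((u @ w) @ w')"
          using word_prob_ge[OF w'(1)] w'(2) by (simp add: f_def b_def)
        also have "\<dots> \<le> mean f (u @ w) (m * D)"
          using mean_ge_word[of f w' "u @ w"] w' by (simp add: f_def)
        finally show ?thesis .
      qed
      then have "mean (\<lambda>_. b) u t \<le> mean (\<lambda>v. mean f v (m * D)) u t"
        by (rule stop_mean_mono_tree)
      then show ?thesis by (simp add: stop_mean_const)
    qed
    also have "\<dots> = mean f u (t + m * D)" by (rule stop_mean_split[symmetric]) simp
    finally have "b \<le> mean f u (t + m * D)" .
    have "b / q \<le> mean f u (t + m * D)"
    proof -
      have "b / q \<le> b / 1" using q b by (intro divide_left_mono) auto
      then show ?thesis using \<open>b \<le> mean f u (t + m * D)\<close> by simp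
    qed
    moreover have "t + m * D \<le> C * q\<^sup>2"
    proof -
      have "t + m * D \<le> m * D + C1 * q" using k by (simp add: t_def)
      also have "\<dots> \<le> m * D * q\<^sup>2 + C1 * q\<^sup>2"
        using q by (intro add_mono) (simp_all add: power2_eq_square)
      finally show ?thesis by (simp add: C_def distrib_right)
    qed
    moreover have "1 \<le> t + m * D" using D(1) m_ge_2 by (simp add: Suc_le_eq)
    ultimately show "\<exists>t. 1 \<le> t \<and> t \<le> C * q\<^sup>2 \<and>
        b / q \<le> mean (\<lambda>v. if near_int (3 / q) up (phase v) then 1 else 0) u t"
      unfolding f_def by blast
  qed
  then show ?thesis using b C1 by (metis gr_implies_not0 neq0_conv)
qed

lemma hitting_exists: "\<exists>C b. 0 < b \<and> (\<forall>N. \<exists>q>N. hitting C b q)"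
proof (cases "\<forall>i<m. cost i - cost 0 \<in> \<rat>")
  case True
  then show ?thesis by (intro hitting_rational) blast
next
  case False
  then show ?thesis using hitting_irrational m_ge_2 by force
qed

section \<open>Choice of parameters\<close>

text \<open>\<open>code_of_hitting_bound\<close> is used with \<open>T0 = q ^ 3\<close>, block
  length \<open>C * q ^ 2\<close>, success probability \<open>b / q\<close> and \<open>K\<close> of
  order \<open>q * ln q\<close>. The assumption \<open>3 \<le> q\<close> ensures
  \<open>ln q \<ge> 1\<close>, and \<open>b \<le> q\<close> makes \<open>b / q\<close> at most
  \<open>1\<close>.\<close>

lemma code_of_hitting:
  fixes b :: real and C :: nat
  assumes b: "0 < b"
  shows "\<exists>c>0. \<forall>q. hitting C b q \<and> 3 \<le> q \<and> b \<le> q \<longrightarrow> (\<exists>W \<phi>.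
    word_based_code m n W \<phi> \<and> decipherable W \<phi> \<and> q \<le> avg_delay p W \<and>
    redundancy m n p W \<phi> \<le> c * avg_delay p W powr (- 5 / 3) \<and>
    max_delay W \<le> c * avg_delay p W * ln (avg_delay p W))"
proof -
  define \<rho> where "\<rho> = Max (p ` {..<m})"
  have fin: "finite (p ` {..<m})" "p ` {..<m} \<noteq> {}" using m_ge_2 by (auto simp: lessThan_empty_iff)
  have \<rho>: "\<rho> < 1" "\<And>i. i < m \<Longrightarrow> p i \<le> \<rho>" using fin p_less_1 by (auto simp: \<rho>_def)
  have \<rho>0: "0 < \<rho>" using \<rho>(2)[of 0] p_pos[of 0] m_ge_2 by simp
  define c0 where "c0 = real n / ln n + n * ln n"
  \<comment> \<open>In units of \<open>1 / q ^ 2\<close>: \<open>9\<close> from the tolerance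
    \<open>3 / q\<close>, \<open>1\<close> from truncation, and the rest from
    \<open>\<rho> ^ (q ^ 3)\<close>. Below, \<open>c2\<close> bounds the average delay in units of
    \<open>q ^ 3\<close>, and \<open>c3\<close> the maximum delay in units of
    \<open>q ^ 3 * ln q\<close>.\<close>
  define c1 where "c1 = 10 + \<rho> / (1 - \<rho>)"
  define c2 where "c2 = 1 + C / b"
  define c3 where "c3 = 1 + (2 / b + 1) * C"
  have n: "real n > 1" "ln n > 0" using n_ge_2 by auto
  have pos: "0 < c0" "0 < c1" "0 < c2" "0 < c3"
    using n \<rho>0 \<rho>(1) b by (auto simp: c0_def c1_def c2_def c3_def intro!: add_pos_nonneg)
  have "\<exists>W \<phi>. word_based_code m n W \<phi> \<and> decipherable W \<phi> \<and> q \<le> avg_delay p W \<and>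
      redundancy m n p W \<phi> \<le> (c0 * c1 * c2 powr (2 / 3) + c3) * avg_delay p W powr (- 5 / 3) \<and>
      max_delay W \<le> (c0 * c1 * c2 powr (2 / 3) + c3) * avg_delay p W * ln (avg_delay p W)"
    if hit: "hitting C b q" and q: "3 \<le> q" "b \<le> q" for q
  proof -
    \<comment> \<open>The least number of blocks for which \<open>exp (- b / q * K)\<close>, a bound
      for the probability of truncation, is at most \<open>1 / q ^ 2\<close>.\<close>
    define K where "K = nat \<lceil>2 / b * q * ln q\<rceil>"
    have ln_q: "1 \<le> ln q"
    proof -
      have "exp 1 \<le> real q" using q(1) e_less_272 by linarith
      then show ?thesis using q(1) by (simp add: ln_ge_iff)
    qed
    have K: "2 / b * q * ln q \<le> K" "K \<le> 2 / b * q * ln q + 1"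
    proof -
      have "0 \<le> 2 / b * q * ln q" using b ln_q by simp
      then show "2 / b * q * ln q \<le> K" "K \<le> 2 / b * q * ln q + 1" unfolding K_def by linarith+
    qed
    have "\<exists>W \<phi>. word_based_code m n W \<phi> \<and> decipherable W \<phi> \<and>
      real (q ^ 3) \<le> avg_delay p W \<and> avg_delay p W \<le> real (q ^ 3) + real (C * q\<^sup>2) / (b / q) \<and>
      max_delay W \<le> q ^ 3 + K * (C * q\<^sup>2) \<and>
      redundancy m n p W \<phi> \<le> (real n / ln n + n * ln n) *
        ((3 / q)\<^sup>2 + (1 - b / q) ^ K + \<rho> ^ (q ^ 3)) / avg_delay p W"
      by (rule code_of_hitting_bound) (use q b \<rho>(2) hit in \<open>auto simp: hitting_def\<close>)
    then obtain W \<phi> where W: "word_based_code m n W \<phi>" "decipherable W \<phi>"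
      "real (q ^ 3) \<le> avg_delay p W" "avg_delay p W \<le> real (q ^ 3) + real (C * q\<^sup>2) / (b / q)"
      "max_delay W \<le> q ^ 3 + K * (C * q\<^sup>2)"
      "redundancy m n p W \<phi> \<le> c0 * ((3 / q)\<^sup>2 + (1 - b / q) ^ K + \<rho> ^ (q ^ 3)) / avg_delay p W"
      unfolding c0_def by blast
    define A where "A = avg_delay p W"
    have q3: "real q \<le> real q ^ 3" using q(1) by (intro self_le_power) auto
    have A_ge: "real q ^ 3 \<le> A" using W(3) by (simp add: A_def)
    then have A: "real q \<le> A" "0 < A" using q3 q(1) by linarith+
    have A_le: "A \<le> c2 * real q ^ 3"
      using W(4) b q(1) by (simp add: A_def c2_def field_simps power2_eq_square power3_eq_cube)
    have "(1 - b / q) ^ K \<le> 1 / q\<^sup>2"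
    proof -
      have "(1 - b / q) ^ K \<le> exp (- (b / q)) ^ K"
        using q b exp_ge_add_one_self[of "- (b / q)"] by (intro power_mono) auto
      also have "\<dots> = exp (- (b / q * K))" by (simp flip: exp_of_nat_mult add: mult.commute)
      also have "\<dots> \<le> exp (- (2 * ln q))"
      proof -
        have "b / q * (2 / b * q * ln q) \<le> b / q * K" using K(1) b by (intro mult_left_mono) auto
        then show ?thesis using b q(1) by simp
      qed
      also have "\<dots> = 1 / q\<^sup>2" using q(1) by (simp add: exp_minus exp_double divide_inverse)
      finally show ?thesis .
    qed
    moreover have "\<rho> ^ (q ^ 3) \<le> \<rho> / (1 - \<rho>) / q\<^sup>2"
    proof -
      have "\<rho> ^ (q ^ 3) \<le> \<rho> / (1 - \<rho>) / real (q ^ 3)"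
        using \<rho>0 \<rho>(1) q(1) by (intro power_le_inverse_linear) auto
      also have "\<dots> \<le> \<rho> / (1 - \<rho>) / q\<^sup>2"
      proof (rule divide_left_mono)
        show "real (q\<^sup>2) \<le> real (q ^ 3)" using q(1) by (intro of_nat_mono power_increasing) auto
      qed (use \<rho>0 \<rho>(1) q(1) in auto)
      finally show ?thesis by simp
    qed
    ultimately have sum_le: "(3 / q)\<^sup>2 + (1 - b / q) ^ K + \<rho> ^ (q ^ 3) \<le> c1 / q\<^sup>2"
      by (simp add: c1_def add_divide_distrib power_divide)
    \<comment> \<open>The source of the exponent: \<open>q ^ 2\<close> is at least of order
      \<open>A powr (2 / 3)\<close>, and the redundancy bound carries one more division by
      \<open>A\<close>.\<close>
    have A23: "1 / q\<^sup>2 \<le> c2 powr (2 / 3) * A powr (- 2 / 3)"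
    proof -
      have "A powr (2 / 3) \<le> (c2 * real q ^ 3) powr (2 / 3)"
        using A_le A(2) by (intro powr_mono2) auto
      also have "\<dots> = c2 powr (2 / 3) * (real q ^ 3) powr (2 / 3)"
        using pos(3) by (simp add: powr_mult)
      also have "(real q ^ 3) powr (2 / 3) = real q ^ 2"
        using q(1) by (simp add: powr_powr flip: powr_numeral)
      finally have le: "A powr (2 / 3) \<le> c2 powr (2 / 3) * real q ^ 2" .
      have "A powr (- 2 / 3) = 1 / A powr (2 / 3)" using powr_minus_divide[of A "2 / 3"] by simp
      moreover have "1 / real q ^ 2 \<le> c2 powr (2 / 3) * (1 / A powr (2 / 3))"
        using le A(2) q(1) by (simp add: pos_divide_le_eq pos_le_divide_eq)
      ultimately show ?thesis by simp
    qed
    have "redundancy m n p W \<phi> \<le> c0 * (c1 / q\<^sup>2) / A"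
      using W(6) sum_le pos(1) A(2) unfolding A_def[symmetric]
      by (elim order_trans) (intro divide_right_mono mult_left_mono, auto)
    also have "\<dots> = c0 * c1 * (1 / q\<^sup>2) / A" by simp
    also have "\<dots> \<le> c0 * c1 * (c2 powr (2 / 3) * A powr (- 2 / 3)) / A"
      using A23 pos A(2) by (intro divide_right_mono mult_left_mono) auto
    also have "\<dots> = c0 * c1 * c2 powr (2 / 3) * A powr (- 5 / 3)"
    proof -
      have "A powr (- 2 / 3) / A = A powr (- 2 / 3 - 1)" using A(2) by (simp only: powr_diff powr_one)
      then have "A powr (- 2 / 3) / A = A powr (- 5 / 3)" by simp
      then show ?thesis by (simp only: mult.assoc times_divide_eq_right[symmetric])
    qed
    also have "\<dots> \<le> (c0 * c1 * c2 powr (2 / 3) + c3) * A powr (- 5 / 3)"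
      using pos(4) by (intro mult_right_mono) auto
    finally have red: "redundancy m n p W \<phi> \<le> (c0 * c1 * c2 powr (2 / 3) + c3) * A powr (- 5 / 3)" .
    have "real (max_delay W) \<le> real (q ^ 3 + K * (C * q\<^sup>2))" using W(5) by (simp only: of_nat_le_iff)
    also have "\<dots> = real q ^ 3 + K * (C * real q ^ 2)" by simp
    also have "\<dots> \<le> real q ^ 3 * ln q + (2 / b * q * ln q + q * ln q) * (C * real q ^ 2)"
    proof (intro add_mono mult_right_mono)
      show "real q ^ 3 \<le> real q ^ 3 * ln q" using ln_q by (simp add: mult_le_cancel_left1)
      have "1 \<le> q * ln q" using ln_q q(1) mult_mono[of 1 "real q" 1 "ln q"] by simp
      then show "real K \<le> 2 / b * q * ln q + q * ln q" using K(2) by linarith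
    qed simp
    also have "\<dots> = c3 * (real q ^ 3 * ln q)"
      by (simp add: c3_def algebra_simps power2_eq_square power3_eq_cube)
    also have "\<dots> \<le> c3 * (A * ln A)"
      using A A_ge ln_q q(1) pos(4) by (intro mult_left_mono mult_mono) auto
    also have "\<dots> \<le> (c0 * c1 * c2 powr (2 / 3) + c3) * (A * ln A)"
      using A q(1) pos by (intro mult_right_mono) auto
    finally have "real (max_delay W) \<le> (c0 * c1 * c2 powr (2 / 3) + c3) * A * ln A" by (simp add: mult.assoc)
    then show ?thesis using W(1,2) A(1) red unfolding A_def by blast
  qed
  moreover have "0 < c0 * c1 * c2 powr (2 / 3) + c3" using pos by (intro add_nonneg_pos) auto
  ultimately show ?thesis by blast
qed

end

theorem corollary3:
  fixes m n :: nat and p :: "nat \<Rightarrow> real"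
  assumes "m \<ge> 2" and "n \<ge> 2"
    and "\<And>i. i < m \<Longrightarrow> p i > 0"
    and "(\<Sum>i<m. p i) = 1"
  shows "\<exists>c::real. c > 0 \<and>
    (\<exists>(\<T>::nat set) (W :: nat \<Rightarrow> nat list set) (\<phi> :: nat \<Rightarrow> nat list \<Rightarrow> nat list).
       infinite \<T> \<and> (\<forall>T\<in>\<T>. T > 0) \<and>
       (\<forall>T\<in>\<T>. word_based_code m n (W T) (\<phi> T) \<and> decipherable (W T) (\<phi> T) \<and>
          avg_delay p (W T) \<ge> 2 \<and>
          redundancy m n p (W T) (\<phi> T) \<le> c * avg_delay p (W T) powr (- 5 / 3) \<and>
          real (max_delay (W T)) \<le> c * avg_delay p (W T) * ln (avg_delay p (W T))) \<and>
       filterlim (\<lambda>T. avg_delay p (W T)) at_top (inf sequentially (principal \<T>)))"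
proof -
  interpret bernoulli_coding m p n
    using assms by unfold_locales
  obtain C b where b: "0 < b" and hit: "\<And>N. \<exists>q>N. hitting C b q"
    using hitting_exists by blast
  obtain c where c: "c > 0" and codes: "\<And>q. hitting C b q \<Longrightarrow> 3 \<le> q \<Longrightarrow> b \<le> q \<Longrightarrow> \<exists>W \<phi>.
    word_based_code m n W \<phi> \<and> decipherable W \<phi> \<and> q \<le> avg_delay p W \<and>
    redundancy m n p W \<phi> \<le> c * avg_delay p W powr (- 5 / 3) \<and>
    max_delay W \<le> c * avg_delay p W * ln (avg_delay p W)"
    using code_of_hitting[OF b, of C] by blast
  \<comment> \<open>The codes are indexed by the scale \<open>q\<close> itself; since the average
    delay is at least \<open>q\<close>, it tends to infinity along \<open>\<T>\<close>.\<close>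
  define \<T> where "\<T> = {q. hitting C b q \<and> 3 \<le> q \<and> b \<le> real q}"
  have "\<forall>q\<in>\<T>. \<exists>W \<phi>.
    word_based_code m n W \<phi> \<and> decipherable W \<phi> \<and> q \<le> avg_delay p W \<and>
    redundancy m n p W \<phi> \<le> c * avg_delay p W powr (- 5 / 3) \<and>
    max_delay W \<le> c * avg_delay p W * ln (avg_delay p W)"
    using codes unfolding \<T>_def by blast
  then obtain W \<phi> where W: "\<forall>q\<in>\<T>. word_based_code m n (W q) (\<phi> q) \<and> decipherable (W q) (\<phi> q) \<and>
    q \<le> avg_delay p (W q) \<and> redundancy m n p (W q) (\<phi> q) \<le> c * avg_delay p (W q) powr (- 5 / 3) \<and>
    max_delay (W q) \<le> c * avg_delay p (W q) * ln (avg_delay p (W q))"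
    by metis
  have "infinite \<T>"
    unfolding infinite_nat_iff_unbounded
  proof
    fix N
    obtain q where q: "q > N + 3 + nat \<lceil>b\<rceil>" "hitting C b q" using hit by blast
    then have "b \<le> real q" by linarith
    then have "q \<in> \<T>" "N < q" using q by (auto simp: \<T>_def)
    then show "\<exists>q>N. q \<in> \<T>" by blast
  qed
  moreover have "\<forall>T\<in>\<T>. T > 0" by (auto simp: \<T>_def)
  moreover have "filterlim (\<lambda>T. avg_delay p (W T)) at_top (inf sequentially (principal \<T>))"
    unfolding filterlim_at_top eventually_inf_principal
  proof
    fix Z :: real
    have "eventually (\<lambda>T. Z \<le> real T) sequentially"
      using filterlim_real_sequentially unfolding filterlim_at_top by blast
    then show "eventually (\<lambda>T. T \<in> \<T> \<longrightarrow> Z \<le> avg_delay p (W T)) sequentially"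
      by eventually_elim (use W in force)
  qed
  moreover have "avg_delay p (W T) \<ge> 2" if "T \<in> \<T>" for T
    using W that by (force simp: \<T>_def)
  ultimately show ?thesis using c W by blast
qed

end
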